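(* Let $\vec p=(p_1,1)$ with $1<p_1<\infty$, and let $\vec a,\vec b,\vec c\in\mathbb{R}^2$, $\vec\alpha\in(-1,\infty)^2$. Then the following are equivalent: (1) $S_{\vec a,\vec b,\vec c}$ is bounded from $L^{\vec p}_{\vec\alpha}(T_B\times T_B)$ to $L^\infty(T_B\times T_B)$; (2) $T_{\vec a,\vec b,\vec c}$ is bounded from $L^{\vec p}_{\vec\alpha}(T_B\times T_B)$ to $L^\infty(T_B\times T_B)$; (3) $a_1>0$, $a_2\ge0$, $p_1(b_1+1)>\alpha_1+1$, $b_2\ge\alpha_2$, $c_1=n+1+a_1+b_1-\frac{n+1+\alpha_1}{p_1}$, and $c_2=a_2+b_2-\alpha_2$.
   Context: Let $n$ be a positive integer. For $z=(z_1,\dots,z_n)\in\mathbb{C}^n$ write $z=x+iy$ with $x,y\in\mathbb{R}^n$, $z'=(z_1,\dots,z_{n-1})$, $y'=(y_1,\dots,y_{n-1})$. Let $B=\{y\in\mathbb{R}^n: |y'|^2<y_n\}$ and $T_B=\{x+iy: x\in\mathbb{R}^n, y\in B\}$. For $z\in T_B$ put $\rho(z)=y_n-|y'|^2>0$, and for $z,u\in T_B$ put $\rho(z,u)=\frac14\big(\sum_{j=1}^{n-1}(z_j-\overline{u_j})^2-2i(z_n-\overline{u_n})\big)$; this has positive real part, and complex powers $\rho(z,u)^c$ are taken with the principal branch. $dV$ is Lebesgue measure on $\mathbb{C}^n$ and $dV_\alpha(z)=\rho(z)^\alpha dV(z)$. For $\vec p=(p_1,p_2)\in[1,\infty]^2$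 and $\vec\alpha=(\alpha_1,\alpha_2)$, $L^{\vec p}_{\vec\alpha}(T_B\times T_B)$ is the space of measurable $f$ on $T_B\times T_B$ with finite mixed norm $\|f\|_{\vec p,\vec\alpha}=\big\{\int_{T_B}\big(\int_{T_B}|f(z,w)|^{p_1}dV_{\alpha_1}(z)\big)^{p_2/p_1}dV_{\alpha_2}(w)\big\}^{1/p_2}$, with the inner (resp. outer) integral replaced by an essential supremum in $z$ (resp. $w$) when $p_1=\infty$ (resp. $p_2=\infty$); when $\vec p=(\infty,\infty)$ this is $L^\infty(T_B\times T_B)$. For $\vec a=(a_1,a_2),\vec b=(b_1,b_2),\vec c=(c_1,c_2)\in\mathbb{R}^2$, $T_{\vec a,\vec b,\vec c}f(z,w)=\rho(z)^{a_1}\rho(w)^{a_2}\int_{T_B}\int_{T_B}\frac{\rho(u)^{b_1}\rho(\eta)^{b_2}}{\rho(z,u)^{c_1}\rho(w,\eta)^{c_2}}f(u,\eta)\,dV(u)\,dV(\eta)$ and $S_{\vec a,\vec b,\vec c}f(z,w)=\rho(z)^{a_1}\rho(w)^{a_2}\int_{T_B}\int_{T_B}\frac{\rho(u)^{b_1}\rho(\eta)^{b_2}}{|\rho(z,u)|^{c_1}|\rho(w,\eta)|^{c_2}}f(u,\eta)\,dV(u)\,dV(\eta)$. An operator is bounded from $X$ to $Y$ if for every $f\in X$ the defining integral converges for a.e. $(z,w)$ and $\|Tf\|_Y\le C\|f\|_X$ with $C$ independent of $f$. *)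

theory Defs
  imports "HOL-Analysis.Analysis"
begin

text \<open>Points of C^n are modelled as functions nat => complex, extensional on {..<n}
  (coordinates z_1..z_n are z 0 .. z (n-1)); Lebesgue measure on C^n is the
  product of Lebesgue (Borel) measure on C over the index set {..<n}.\<close>

definition Leb :: "nat \<Rightarrow> (nat \<Rightarrow> complex) measure" where
  "Leb n = PiM {..<n} (\<lambda>_. lborel)"

definition rho :: "nat \<Rightarrow> (nat \<Rightarrow> complex) \<Rightarrow> real" where
  "rho n z = Im (z (n - 1)) - (\<Sum>j<n - 1. (Im (z j))\<^sup>2)"

definition TB :: "nat \<Rightarrow> (nat \<Rightarrow> complex) set" where
  "TB n = {z \<in> space (Leb n). 0 < rho n z}"

definition rho2 :: "nat \<Rightarrow> (nat \<Rightarrow> complex) \<Rightarrow> (nat \<Rightarrow> complex) \<Rightarrow> complex" where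
  "rho2 n z u = (1/4) * ((\<Sum>j<n - 1. (z j - cnj (u j))\<^sup>2) - 2 * \<i> * (z (n - 1) - cnj (u (n - 1))))"

definition enn_root :: "real \<Rightarrow> ennreal \<Rightarrow> ennreal" where
  "enn_root p x = (if x = \<infinity> then \<infinity> else ennreal (enn2real x powr (1 / p)))"

definition mixnorm :: "nat \<Rightarrow> real \<Rightarrow> real \<Rightarrow> real \<Rightarrow>
    ((nat \<Rightarrow> complex) \<times> (nat \<Rightarrow> complex) \<Rightarrow> complex) \<Rightarrow> ennreal" where
  "mixnorm n p1 al1 al2 f =
     (\<integral>\<^sup>+ w. indicator (TB n) w *
        enn_root p1 (\<integral>\<^sup>+ z. indicator (TB n) z *
            ennreal (cmod (f (z, w)) powr p1 * rho n z powr al1) \<partial>Leb n)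
        * ennreal (rho n w powr al2) \<partial>Leb n)"

definition Tker :: "nat \<Rightarrow> real \<times> real \<Rightarrow> real \<times> real \<Rightarrow> real \<times> real \<Rightarrow>
    (nat \<Rightarrow> complex) \<Rightarrow> (nat \<Rightarrow> complex) \<Rightarrow> (nat \<Rightarrow> complex) \<Rightarrow> (nat \<Rightarrow> complex) \<Rightarrow> complex" where
  "Tker n a b c z w u \<eta> =
     complex_of_real (rho n z powr fst a * rho n w powr snd a * rho n u powr fst b * rho n \<eta> powr snd b)
     / (rho2 n z u powr complex_of_real (fst c) * rho2 n w \<eta> powr complex_of_real (snd c))"

definition Sker :: "nat \<Rightarrow> real \<times> real \<Rightarrow> real \<times> real \<Rightarrow> real \<times> real \<Rightarrow>
    (nat \<Rightarrow> complex) \<Rightarrow> (nat \<Rightarrow> complex) \<Rightarrow> (nat \<Rightarrow> complex) \<Rightarrow> (nat \<Rightarrow> complex) \<Rightarrow> complex" where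
  "Sker n a b c z w u \<eta> =
     complex_of_real (rho n z powr fst a * rho n w powr snd a * rho n u powr fst b * rho n \<eta> powr snd b
     / (cmod (rho2 n z u) powr fst c * cmod (rho2 n w \<eta>) powr snd c))"

definition intop :: "nat \<Rightarrow> ((nat \<Rightarrow> complex) \<Rightarrow> (nat \<Rightarrow> complex) \<Rightarrow> (nat \<Rightarrow> complex) \<Rightarrow> (nat \<Rightarrow> complex) \<Rightarrow> complex)
    \<Rightarrow> ((nat \<Rightarrow> complex) \<times> (nat \<Rightarrow> complex) \<Rightarrow> complex) \<Rightarrow> (nat \<Rightarrow> complex) \<Rightarrow> (nat \<Rightarrow> complex) \<Rightarrow> complex" where
  "intop n K f z w = (\<integral>(u, \<eta>). indicator (TB n \<times> TB n) (u, \<eta>) *\<^sub>R (K z w u \<eta> * f (u, \<eta>)) \<partial>(Leb n \<Otimes>\<^sub>M Leb n))"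

definition bounded_to_Linf :: "nat \<Rightarrow> real \<Rightarrow> real \<Rightarrow> real \<Rightarrow>
    ((nat \<Rightarrow> complex) \<Rightarrow> (nat \<Rightarrow> complex) \<Rightarrow> (nat \<Rightarrow> complex) \<Rightarrow> (nat \<Rightarrow> complex) \<Rightarrow> complex) \<Rightarrow> bool" where
  "bounded_to_Linf n p1 al1 al2 K \<longleftrightarrow>
     (\<exists>C::real. \<forall>f. f \<in> borel_measurable (Leb n \<Otimes>\<^sub>M Leb n) \<and> mixnorm n p1 al1 al2 f < \<infinity> \<longrightarrow>
        (AE zw in Leb n \<Otimes>\<^sub>M Leb n. zw \<in> TB n \<times> TB n \<longrightarrow>
           integrable (Leb n \<Otimes>\<^sub>M Leb n)
             (\<lambda>(u, \<eta>). indicator (TB n \<times> TB n) (u, \<eta>) *\<^sub>R (K (fst zw) (snd zw) u \<eta> * f (u, \<eta>)))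
           \<and> ennreal (cmod (intop n K f (fst zw) (snd zw))) \<le> ennreal C * mixnorm n p1 al1 al2 f))"

end

theory Submission
  imports Defs
begin

text \<open>
  Both kernels have the same modulus, a product of a kernel in \<open>(z, u)\<close> and one in \<open>(w, \<eta>)\<close>.
  By duality, boundedness from \<open>L\<^sup>(\<^sup>p\<^sup>1\<^sup>,\<^sup>1\<^sup>)\<close> to \<open>L\<^sup>\<infinity>\<close> means that the \<open>L\<^sup>q\<close> norm in \<open>u\<close> of the first factor
  times the supremum in \<open>\<eta>\<close> of the second is bounded uniformly in \<open>(z, w)\<close>. After translating
  \<open>Re u\<^sub>n\<close> and \<open>Im u\<^sub>n\<close> the integral of \<open>rho(u)\<^sup>s |rho2(z,u)|\<^sup>-\<^sup>t\<close> splits into one-dimensional ones and equals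
  a positive constant times \<open>rho(z)\<close> to the power \<open>n + 1 + s - t\<close>, where the constant is finite iff
  \<open>s > -1\<close> and \<open>t > n + 1 + s\<close>; this gives the conditions on \<open>a\<^sub>1, b\<^sub>1, c\<^sub>1\<close>. The supremum is
  controlled by \<open>|rho2(w,\<eta>)| \<ge> (rho(w) + rho(\<eta>))/2\<close>, with equality on the imaginary \<open>z\<^sub>n\<close>-axis, which gives the
  conditions on \<open>a\<^sub>2, b\<^sub>2, c\<^sub>2\<close>.
\<close>

text \<open>The extremal function for the duality depends on the point \<open>(z, w)\<close>,
  whereas boundedness controls \<open>intop n K f\<close> only off a null set that depends on
  \<open>f\<close>. This is why the necessity part works with test functions supported in the sets
  \<open>TB_exhaust\<close> and with approximating sequences. What comes out is an inequality whose
  left side depends on \<open>z\<close> alone and whose right side depends on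
  \<open>(w, \<eta>)\<close> alone. As the left side is a constant times a pure power of
  \<open>rho n z\<close>, letting \<open>rho n z\<close> run through (0, \<infinity>) forces the
  exponent to vanish; finiteness of the constant and variation of \<open>(w, \<eta>)\<close> then
  decouple the remaining conditions. The inequalities for the first variable are strict because they
  express convergence of an integral. Those for the second are weak because the dual of an L^1 norm
  is a supremum, which may stay finite in the limiting case. The integrals over \<open>u\<close>
  take values in \<open>ennreal\<close>, so their formulas hold for all exponents and each
  finiteness criterion can be read in both directions.\<close>

section \<open>One-dimensional power integrals and their finiteness\<close>

text \<open>For \<open>e \<ge> -1\<close> compare with 1/x: its integral over \<open>{1..b}\<close>
  is \<open>ln b\<close>, and \<open>b = exp (r+1)\<close> exceeds any supposed finite value
  \<open>r\<close>.\<close>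

lemma nn_integral_powr_atLeast_1:
  fixes e :: real
  shows "(\<integral>\<^sup>+x. ennreal (x powr e) * indicator {1..} x \<partial>lborel) < \<infinity> \<longleftrightarrow> e < -1"
proof
  assume e: "e < -1"
  have "(\<integral>\<^sup>+x. ennreal (x powr e) * indicator {1..} x \<partial>lborel) = ennreal (0 - 1 powr (e+1) / (e+1))"
  proof (rule nn_integral_FTC_atLeast[where F="\<lambda>x. x powr (e+1) / (e+1)" and T=0])
    show "DERIV (\<lambda>x. x powr (e+1) / (e+1)) x :> x powr e" if "1 \<le> x" for x
      using that e by (auto intro!: derivative_eq_intros)
    have "((\<lambda>x. x powr (e+1)) \<longlongrightarrow> 0) at_top"
      using e by (intro tendsto_neg_powr filterlim_ident) auto
    from tendsto_divide[OF this tendsto_const[of "e+1"]] e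
    show "((\<lambda>x. x powr (e+1) / (e+1)) \<longlongrightarrow> 0) at_top" by simp
  qed auto
  then show "(\<integral>\<^sup>+x. ennreal (x powr e) * indicator {1..} x \<partial>lborel) < \<infinity>" by simp
next
  assume fin: "(\<integral>\<^sup>+x. ennreal (x powr e) * indicator {1..} x \<partial>lborel) < \<infinity>" (is "?I < _")
  show "e < -1"
  proof (rule ccontr)
    assume "\<not> e < -1"
    then have e: "e \<ge> -1" by simp
    have bd: "ennreal (ln b) \<le> ?I" if b: "1 \<le> b" for b
    proof -
      have "(\<integral>\<^sup>+x. ennreal (1/x) * indicator {1..b} x \<partial>lborel) = ennreal (ln b - ln 1)"
        using b by (intro nn_integral_FTC_Icc) (auto intro!: derivative_eq_intros simp: has_field_derivative_at_within)
      moreover have "(\<integral>\<^sup>+x. ennreal (1/x) * indicator {1..b} x \<partial>lborel) \<le> ?I"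
      proof (rule nn_integral_mono)
        fix x :: real
        have "1/x \<le> x powr e" if "1 \<le> x"
          using powr_mono[of "-1" e x] that e by (simp add: powr_minus_divide)
        then show "ennreal (1/x) * indicator {1..b} x \<le> ennreal (x powr e) * indicator {1..} x"
          by (auto simp: indicator_def intro!: ennreal_leI)
      qed
      ultimately show ?thesis by simp
    qed
    obtain r where r: "?I = ennreal r" "r \<ge> 0" using fin by (cases ?I) auto
    have "ln (exp (r+1)) \<le> r"
      using bd[of "exp (r+1)"] r by (auto simp: ennreal_le_iff)
    then show False by simp
  qed
qed

lemma nn_integral_powr_unit_interval:
  fixes s :: real
  shows "(\<integral>\<^sup>+x. ennreal (x powr s) * indicator {0<..1} x \<partial>lborel) < \<infinity> \<longleftrightarrow> s > -1"
proof
  assume s: "s > -1"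
  have "((\<lambda>x. x powr s) has_integral (1 powr (s+1) / (s+1))) {0..1}"
    by (rule has_integral_powr_from_0) (use s in auto)
  then have "(\<integral>\<^sup>+x. ennreal (x powr s) * indicator {0..1} x \<partial>lborel) = ennreal (1 powr (s+1) / (s+1))"
    by (intro nn_integral_has_integral_lebesgue') auto
  moreover have "(\<integral>\<^sup>+x. ennreal (x powr s) * indicator {0<..1} x \<partial>lborel)
       \<le> (\<integral>\<^sup>+x. ennreal (x powr s) * indicator {0..1} x \<partial>lborel)"
    by (intro nn_integral_mono) (auto simp: indicator_def)
  ultimately show "(\<integral>\<^sup>+x. ennreal (x powr s) * indicator {0<..1} x \<partial>lborel) < \<infinity>"
    by (simp add: le_less_trans)
next
  assume fin: "(\<integral>\<^sup>+x. ennreal (x powr s) * indicator {0<..1} x \<partial>lborel) < \<infinity>" (is "?I < _")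
  show "s > -1"
  proof (rule ccontr)
    assume "\<not> s > -1"
    then have s: "s \<le> -1" by simp
    have bd: "ennreal (- ln b) \<le> ?I" if b: "0 < b" "b \<le> 1" for b
    proof -
      have "(\<integral>\<^sup>+x. ennreal (1/x) * indicator {b..1} x \<partial>lborel) = ennreal (ln 1 - ln b)"
        using b by (intro nn_integral_FTC_Icc) (auto intro!: derivative_eq_intros simp: has_field_derivative_at_within)
      moreover have "(\<integral>\<^sup>+x. ennreal (1/x) * indicator {b..1} x \<partial>lborel) \<le> ?I"
      proof (rule nn_integral_mono)
        fix x :: real
        have "1/x \<le> x powr s" if "x \<le> 1" "0 < x"
          using powr_mono'[of s "-1" x] that s by (simp add: powr_minus_divide)
        then show "ennreal (1/x) * indicator {b..1} x \<le> ennreal (x powr s) * indicator {0<..1} x"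
          using b by (auto simp: indicator_def intro!: ennreal_leI)
      qed
      ultimately show ?thesis by simp
    qed
    obtain r where r: "?I = ennreal r" "r \<ge> 0" using fin by (cases ?I) auto
    have "- ln (exp (-(r+1))) \<le> r"
      using bd[of "exp (-(r+1))"] r by (auto simp: ennreal_le_iff)
    then show False by simp
  qed
qed

text \<open>For k > 1/2 this is the Beta value B(1/2, k - 1/2); in \<open>ennreal\<close> it makes
  sense for every k.\<close>

definition cauchy_const :: "real \<Rightarrow> ennreal" where
  "cauchy_const k = (\<integral>\<^sup>+x. ennreal ((1 + x\<^sup>2) powr -k) \<partial>lborel)"

text \<open>In the convergent range this is 2^(-s-1) B(s+1, k-s-1). The 2 in the integrand matches
  the coefficient of \<open>rho n u\<close> in \<open>Re_rho2\<close>.\<close>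

definition beta_const :: "real \<Rightarrow> real \<Rightarrow> ennreal" where
  "beta_const s k = (\<integral>\<^sup>+r. ennreal (r powr s * (1 + 2*r) powr -k) * indicator {0<..} r \<partial>lborel)"

lemma nn_integral_pos_of_interval:
  assumes [measurable]: "f \<in> borel_measurable borel"
    and "\<And>x. a < x \<Longrightarrow> x < b \<Longrightarrow> f x > (0::ennreal)" and "a < (b::real)"
  shows "(\<integral>\<^sup>+x. f x \<partial>lborel) > 0"
proof (rule ccontr)
  assume "\<not> ?thesis"
  then have "AE x in lborel. f x = 0" by (simp add: nn_integral_0_iff_AE)
  then have "AE x in lborel. x \<notin> {a<..<b}"
    by (rule eventually_mono) (use assms(2) in force)
  then have "emeasure lborel {a<..<b} = 0"
    by (subst (asm) AE_iff_measurable[of "{a<..<b}"]) auto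
  then show False using assms(3) by simp
qed

lemma cauchy_const_pos: "cauchy_const k > 0"
  unfolding cauchy_const_def
proof (rule nn_integral_pos_of_interval[of _ 0 1])
  fix x :: real
  have "1 + x\<^sup>2 \<noteq> 0" by (smt (verit) zero_le_power2)
  then show "0 < ennreal ((1 + x\<^sup>2) powr -k)" by simp
qed auto

lemma beta_const_pos: "beta_const s k > 0"
  unfolding beta_const_def
  by (rule nn_integral_pos_of_interval[of _ 0 1]) (auto simp: indicator_def)

lemma cauchy_const_finite: "cauchy_const k < \<infinity> \<longleftrightarrow> k > 1/2"
proof
  assume k: "k > 1/2"
  let ?p = "\<lambda>x. ennreal (x powr (-2*k)) * indicator {1..} x"
  have fin: "(\<integral>\<^sup>+x. ?p x \<partial>lborel) < \<infinity>"
    using k by (subst nn_integral_powr_atLeast_1) auto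
  have "(\<integral>\<^sup>+x. ?p x \<partial>lborel) = (\<integral>\<^sup>+x. ?p (-x) \<partial>lborel)"
    by (subst nn_integral_real_affine[where c="-1" and t=0]) auto
  then have fin': "(\<integral>\<^sup>+x. ?p (-x) \<partial>lborel) < \<infinity>" using fin by simp
  have le: "(1 + x\<^sup>2) powr -k \<le> y powr (-2*k)" if "y \<ge> 1" "y\<^sup>2 = x\<^sup>2" for x y :: real
  proof -
    have "(1 + x\<^sup>2) powr -k \<le> (x\<^sup>2) powr -k"
      using k that by (intro powr_mono2') (auto simp flip: that(2))
    also have "\<dots> = y powr (-2*k)"
      using that(1) by (simp flip: that(2) add: powr_powr flip: powr_numeral)
    finally show ?thesis .
  qed
  have "cauchy_const k \<le> (\<integral>\<^sup>+x. indicator {-1..1} x + (?p x + ?p (-x)) \<partial>lborel)"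
    unfolding cauchy_const_def
  proof (rule nn_integral_mono)
    fix x :: real
    consider "x \<ge> 1" | "-x \<ge> 1" | "-1 < x" "x < 1" by linarith
    then show "ennreal ((1 + x\<^sup>2) powr -k) \<le> indicator {-1..1} x + (?p x + ?p (-x))"
    proof cases
      case 1
      then have "ennreal ((1 + x\<^sup>2) powr -k) \<le> ?p x" using le[of x x] by (auto intro!: ennreal_leI)
      then show ?thesis by (simp add: add_increasing add_increasing2)
    next
      case 2
      then have "ennreal ((1 + x\<^sup>2) powr -k) \<le> ?p (-x)" using le[of "-x" x] by (auto intro!: ennreal_leI)
      then show ?thesis by (simp add: add_increasing add_increasing2)
    next
      case 3
      have "(1 + x\<^sup>2) powr -k \<le> 1 powr -k"
        using k by (intro powr_mono2') auto
      then have "ennreal ((1 + x\<^sup>2) powr -k) \<le> indicator {-1..1} x" using 3 by simp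
      then show ?thesis by (simp add: add_increasing add_increasing2)
    qed
  qed
  also have "\<dots> = 2 + ((\<integral>\<^sup>+x. ?p x \<partial>lborel) + (\<integral>\<^sup>+x. ?p (-x) \<partial>lborel))"
    by (subst nn_integral_add; (subst nn_integral_add)?) (auto simp: nn_integral_add)
  also have "\<dots> < \<infinity>" using fin fin' by simp
  finally show "cauchy_const k < \<infinity>" .
next
  assume fin: "cauchy_const k < \<infinity>"
  show "k > 1/2"
  proof (rule ccontr)
    assume "\<not> k > 1/2"
    then have k: "k \<le> 1/2" by simp
    have "(\<integral>\<^sup>+x. ennreal (1/2) * (ennreal (x powr -1) * indicator {1..} x) \<partial>lborel) \<le> cauchy_const k"
      unfolding cauchy_const_def
    proof (rule nn_integral_mono)
      fix x :: real
      have le: "1/2 * x powr -1 \<le> (1 + x\<^sup>2) powr -k" if x: "1 \<le> x"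
      proof -
        \<comment> \<open>Since the base is at least 1, k = 1/2 is the worst case; there
          \<open>1 + x^2 \<le> (2*x)^2\<close> for x \<ge> 1 bounds the integrand below by
          1/(2x).\<close>
        have "1/2 * x powr -1 = ((2*x)\<^sup>2) powr (-1/2)"
          using x by (simp add: powr_minus_divide powr_half_sqrt real_sqrt_mult)
        also have "\<dots> \<le> (1 + x\<^sup>2) powr (-1/2)"
        proof (rule powr_mono2')
          have "1 \<le> x\<^sup>2" using x by simp
          then show "1 + x\<^sup>2 \<le> (2*x)\<^sup>2" by (simp add: power2_eq_square)
          show "0 < 1 + x\<^sup>2" by (smt (verit) zero_le_power2)
        qed simp
        also have "\<dots> \<le> (1 + x\<^sup>2) powr -k" using k by (intro powr_mono) auto
        finally show ?thesis .
      qed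
      show "ennreal (1/2) * (ennreal (x powr -1) * indicator {1..} x) \<le> ennreal ((1 + x\<^sup>2) powr -k)"
      proof (cases "1 \<le> x")
        case True
        then have "ennreal (1/2 * x powr -1) \<le> ennreal ((1 + x\<^sup>2) powr -k)"
          using le by (intro ennreal_leI)
        then show ?thesis using True by (subst (asm) ennreal_mult) auto
      qed simp
    qed
    also note fin
    finally have "ennreal (1/2) * (\<integral>\<^sup>+x. (ennreal (x powr -1) * indicator {1..} x) \<partial>lborel) < \<infinity>"
      by (subst (asm) nn_integral_cmult) auto
    then have "(\<integral>\<^sup>+x. (ennreal (x powr -1) * indicator {1..} x) \<partial>lborel) < \<infinity>"
      by (auto simp: ennreal_mult_less_top)
    then show False by (subst (asm) nn_integral_powr_atLeast_1) simp
  qed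
qed

lemma beta_const_finite: "beta_const s k < \<infinity> \<longleftrightarrow> s > -1 \<and> k > s + 1"
proof
  assume a: "s > -1 \<and> k > s + 1"
  let ?f = "\<lambda>x. ennreal (x powr s) * indicator {0<..1} x"
  let ?g = "\<lambda>x. ennreal (x powr (s-k)) * indicator {1..} x"
  have "beta_const s k \<le> (\<integral>\<^sup>+x. ?f x + ?g x \<partial>lborel)"
    unfolding beta_const_def
  proof (rule nn_integral_mono)
    fix r :: real
    consider "r \<le> 0" | "0 < r" "r \<le> 1" | "1 \<le> r" by linarith
    then show "ennreal (r powr s * (1 + 2*r) powr -k) * indicator {0<..} r \<le> ?f r + ?g r"
    proof cases
      case 2
      have "(1 + 2*r) powr -k \<le> 1 powr -k"
        using a 2 by (intro powr_mono2') auto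
      then have "r powr s * (1 + 2*r) powr -k \<le> r powr s" by (simp add: mult_left_le)
      with 2 have "ennreal (r powr s * (1 + 2*r) powr -k) * indicator {0<..} r \<le> ?f r"
        by (auto intro!: ennreal_leI)
      then show ?thesis by (simp add: add_increasing2)
    next
      case 3
      have "(1 + 2*r) powr -k \<le> r powr -k"
        using a 3 by (intro powr_mono2') auto
      then have "r powr s * (1 + 2*r) powr -k \<le> r powr s * r powr -k" by (simp add: mult_left_mono)
      also have "\<dots> = r powr (s-k)" by (simp flip: powr_add)
      finally have "ennreal (r powr s * (1 + 2*r) powr -k) * indicator {0<..} r \<le> ?g r"
        using 3 by (auto intro!: ennreal_leI)
      then show ?thesis by (simp add: add_increasing)
    qed simp
  qed
  also have "\<dots> = (\<integral>\<^sup>+x. ?f x \<partial>lborel) + (\<integral>\<^sup>+x. ?g x \<partial>lborel)"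
    by (rule nn_integral_add) auto
  also have "\<dots> < \<infinity>"
    using a nn_integral_powr_atLeast_1[of "s-k"] nn_integral_powr_unit_interval[of s] by simp
  finally show "beta_const s k < \<infinity>" .
next
  assume fin: "beta_const s k < \<infinity>"
  \<comment> \<open>The sign of k is still unknown, so the constant covers both signs. The 3 comes
    from 1 \<le> 1+2r \<le> 3 on (0,1] and r \<le> 1+2r \<le> 3r on [1,\<infinity>), which make the
    integrand comparable to r^s and r^(s-k) there.\<close>
  define C where "C = min 1 (3 powr -k)"
  have C: "C > 0" by (simp add: C_def)
  have low: "C * y powr -k \<le> x powr -k" if "0 < y" "y \<le> x" "x \<le> 3*y" for x y
  proof (cases "k \<ge> 0")
    case True
    have "C * y powr -k \<le> 3 powr -k * y powr -k" by (intro mult_right_mono) (auto simp: C_def)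
    also have "\<dots> = (3*y) powr -k" using that by (simp add: powr_mult)
    also have "\<dots> \<le> x powr -k" using that True by (intro powr_mono2') auto
    finally show ?thesis .
  next
    case False
    have "C * y powr -k \<le> 1 * y powr -k" by (intro mult_right_mono) (auto simp: C_def)
    also have "\<dots> \<le> x powr -k" using that False by (simp add: powr_mono2)
    finally show ?thesis .
  qed
  have 1: "ennreal C * (\<integral>\<^sup>+x. ennreal (x powr s) * indicator {0<..1} x \<partial>lborel) \<le> beta_const s k"
    unfolding beta_const_def
  proof (subst nn_integral_cmult[symmetric], simp, rule nn_integral_mono)
    fix r :: real
    have "C * r powr s \<le> r powr s * (1 + 2*r) powr -k" if "0 < r" "r \<le> 1"
      using mult_left_mono[OF low[of 1 "1+2*r"], of "r powr s"] that by (simp add: mult.commute)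
    then show "ennreal C * (ennreal (r powr s) * indicator {0<..1} r)
       \<le> ennreal (r powr s * (1 + 2*r) powr -k) * indicator {0<..} r"
      using C by (auto simp: indicator_def ennreal_mult[symmetric] intro!: ennreal_leI)
  qed
  have 2: "ennreal C * (\<integral>\<^sup>+x. ennreal (x powr (s-k)) * indicator {1..} x \<partial>lborel) \<le> beta_const s k"
    unfolding beta_const_def
  proof (subst nn_integral_cmult[symmetric], simp, rule nn_integral_mono)
    fix r :: real
    have "C * r powr (s-k) \<le> r powr s * (1 + 2*r) powr -k" if "1 \<le> r"
    proof -
      have "C * r powr (s-k) = r powr s * (C * r powr -k)"
        by (simp add: powr_add[symmetric])
      also have "\<dots> \<le> r powr s * (1 + 2*r) powr -k"
        using that by (intro mult_left_mono low) auto
      finally show ?thesis .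
    qed
    then show "ennreal C * (ennreal (r powr (s-k)) * indicator {1..} r)
       \<le> ennreal (r powr s * (1 + 2*r) powr -k) * indicator {0<..} r"
      using C by (auto simp: indicator_def ennreal_mult[symmetric] intro!: ennreal_leI)
  qed
  from 1 2 fin have "ennreal C * (\<integral>\<^sup>+x. ennreal (x powr s) * indicator {0<..1} x \<partial>lborel) < \<infinity>"
    "ennreal C * (\<integral>\<^sup>+x. ennreal (x powr (s-k)) * indicator {1..} x \<partial>lborel) < \<infinity>"
    by (auto intro: le_less_trans)
  then have "(\<integral>\<^sup>+x. ennreal (x powr s) * indicator {0<..1} x \<partial>lborel) < \<infinity>"
    "(\<integral>\<^sup>+x. ennreal (x powr (s-k)) * indicator {1..} x \<partial>lborel) < \<infinity>"
    using C by (auto simp: ennreal_mult_less_top)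
  then show "s > -1 \<and> k > s + 1"
    by (subst (asm) nn_integral_powr_atLeast_1, subst (asm) nn_integral_powr_unit_interval) simp
qed

text \<open>Substitute x0 + sqrt(A) x for x: the Jacobian contributes A^(1/2) and the integrand
  A^(-k). If k \<le> 1/2, both sides are infinite.\<close>

lemma nn_integral_quadratic_powr:
  fixes A x0 :: real assumes A: "A > 0"
  shows "(\<integral>\<^sup>+x. ennreal ((A + (x0 - x)\<^sup>2) powr -k) \<partial>lborel) = ennreal (A powr (1/2 - k)) * cauchy_const k"
proof -
  have eq: "(A + (sqrt A * x)\<^sup>2) powr -k = A powr -k * (1 + x\<^sup>2) powr -k" for x
  proof -
    have "A + (sqrt A * x)\<^sup>2 = A * (1 + x\<^sup>2)"
      using A by (simp add: power_mult_distrib algebra_simps)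
    then show ?thesis using A by (simp add: powr_mult)
  qed
  have "(\<integral>\<^sup>+x. ennreal ((A + (x0 - x)\<^sup>2) powr -k) \<partial>lborel)
     = ennreal \<bar>sqrt A\<bar> * (\<integral>\<^sup>+x. ennreal (A powr -k) * ennreal ((1 + x\<^sup>2) powr -k) \<partial>lborel)"
    using A by (subst nn_integral_real_affine[where c="sqrt A" and t=x0]) (auto simp: eq ennreal_mult)
  also have "\<dots> = ennreal \<bar>sqrt A\<bar> * (ennreal (A powr -k) * cauchy_const k)"
    by (subst nn_integral_cmult) (auto simp: cauchy_const_def)
  also have "\<dots> = ennreal (A powr (1/2) * A powr -k) * cauchy_const k"
    using A by (simp add: ennreal_mult powr_half_sqrt mult.assoc)
  also have "A powr (1/2) * A powr -k = A powr (1/2 - k)"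
    by (simp flip: powr_add)
  finally show ?thesis .
qed

lemma nn_integral_beta_powr:
  fixes A B :: real assumes A: "A > 0"
  shows "(\<integral>\<^sup>+y. ennreal ((y - B) powr s * (A + 2*(y - B)) powr -k) * indicator {B<..} y \<partial>lborel)
     = ennreal (A powr (s + 1 - k)) * beta_const s k"
proof -
  have eq: "ennreal ((A*r) powr s * (A + 2*(A*r)) powr -k) * indicator {B<..} (B + A*r)
      = ennreal (A powr (s - k)) * (ennreal (r powr s * (1 + 2*r) powr -k) * indicator {0<..} r)" for r
  proof (cases "r > 0")
    case True
    have "A + 2 * (A * r) = A * (1 + 2*r)" by (simp add: algebra_simps)
    moreover have "A powr s * A powr -k = A powr (s-k)" by (simp flip: powr_add)
    ultimately have "(A*r) powr s * (A + 2 * (A * r)) powr -k = A powr (s-k) * (r powr s * (1 + 2*r) powr -k)"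
      using A True by (simp add: powr_mult mult.assoc mult.left_commute)
    then show ?thesis using A True by (simp add: ennreal_mult)
  qed (use A in \<open>auto simp: zero_less_mult_iff\<close>)
  have "(\<integral>\<^sup>+y. ennreal ((y - B) powr s * (A + 2*(y - B)) powr -k) * indicator {B<..} y \<partial>lborel)
     = ennreal \<bar>A\<bar> * (\<integral>\<^sup>+r. ennreal (A powr (s - k)) * (ennreal (r powr s * (1 + 2*r) powr -k) * indicator {0<..} r) \<partial>lborel)"
    using A by (subst nn_integral_real_affine[where c=A and t=B]) (auto simp: eq)
  also have "\<dots> = ennreal \<bar>A\<bar> * (ennreal (A powr (s - k)) * beta_const s k)"
    by (subst nn_integral_cmult) (auto simp: beta_const_def)
  also have "\<dots> = ennreal (A powr 1 * A powr (s - k)) * beta_const s k"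
    using A by (simp add: ennreal_mult mult.assoc)
  also have "A powr 1 * A powr (s - k) = A powr (s + 1 - k)"
    by (simp flip: powr_add add: algebra_simps del: powr_one powr_one')
  finally show ?thesis .
qed

section \<open>Integration over C as iterated real integration\<close>

lemma borel_measurable_Complex_pair [measurable]:
  "(\<lambda>(x, y). Complex x y) \<in> borel_measurable (lborel \<Otimes>\<^sub>M lborel)"
proof -
  have "(\<lambda>p. Complex (fst p) (snd p)) \<in> borel_measurable borel"
    by (intro borel_measurable_continuous_onI continuous_intros)
  then show ?thesis
    by (subst lborel_prod) (simp add: split_beta')
qed

lemma lborel_complex_eq_distr:
  "(lborel :: complex measure) = distr (lborel \<Otimes>\<^sub>M lborel) borel (\<lambda>(x, y). Complex x y)"
proof (rule lborel_eqI)
  fix l u :: complex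
  assume le: "\<And>b. b \<in> Basis \<Longrightarrow> l \<bullet> b \<le> u \<bullet> b"
  have le': "Re l \<le> Re u" "Im l \<le> Im u"
    using le[of 1] le[of \<i>] by (auto simp: Basis_complex_def)
  have "emeasure (distr (lborel \<Otimes>\<^sub>M lborel) borel (\<lambda>(x, y). Complex x y)) (box l u)
     = emeasure (lborel \<Otimes>\<^sub>M lborel) ({Re l<..<Re u} \<times> {Im l<..<Im u})"
    by (subst emeasure_distr)
       (auto intro!: arg_cong2[where f=emeasure] simp: in_box_complex_iff space_pair_measure)
  also have "\<dots> = ennreal ((Re u - Re l) * (Im u - Im l))"
    using le' by (subst lborel.emeasure_pair_measure_Times) (auto simp: ennreal_mult)
  finally show "emeasure (distr (lborel \<Otimes>\<^sub>M lborel) borel (\<lambda>(x, y). Complex x y)) (box l u)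
     = ennreal (\<Prod>b\<in>Basis. (u - l) \<bullet> b)"
    by (simp add: Basis_complex_def)
qed simp

lemma nn_integral_lborel_complex:
  assumes [measurable]: "f \<in> borel_measurable (borel :: complex measure)"
  shows "(\<integral>\<^sup>+v. f v \<partial>lborel) = (\<integral>\<^sup>+y. (\<integral>\<^sup>+x. f (Complex x y) \<partial>lborel) \<partial>lborel)"
proof -
  have "(\<integral>\<^sup>+v. f v \<partial>lborel) = (\<integral>\<^sup>+p. f (case p of (x, y) \<Rightarrow> Complex x y) \<partial>(lborel \<Otimes>\<^sub>M lborel))"
    by (subst lborel_complex_eq_distr, subst nn_integral_distr) auto
  also have "\<dots> = (\<integral>\<^sup>+y. (\<integral>\<^sup>+x. f (case (x, y) of (x, y) \<Rightarrow> Complex x y) \<partial>lborel) \<partial>lborel)"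
    by (rule lborel_pair.nn_integral_snd[symmetric]) measurable
  finally show ?thesis by simp
qed

text \<open>Integrating over the real part leaves the same kind of integral in the imaginary part
  with exponent k - 1/2, hence the two constants.\<close>

lemma nn_integral_complex_quadratic_powr:
  fixes A :: real assumes A: "A > 0"
  shows "(\<integral>\<^sup>+v. ennreal ((A + (cmod (v0 - v))\<^sup>2) powr -k) \<partial>lborel)
    = ennreal (A powr (1 - k)) * (cauchy_const k * cauchy_const (k - 1/2))"
proof -
  have "(\<integral>\<^sup>+v. ennreal ((A + (cmod (v0 - v))\<^sup>2) powr -k) \<partial>lborel)
     = (\<integral>\<^sup>+y. (\<integral>\<^sup>+x. ennreal (((A + (Im v0 - y)\<^sup>2) + (Re v0 - x)\<^sup>2) powr -k) \<partial>lborel) \<partial>lborel)"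
    by (subst nn_integral_lborel_complex) (auto simp: cmod_power2 add_ac)
  also have "\<dots> = (\<integral>\<^sup>+y. cauchy_const k * ennreal ((A + (Im v0 - y)\<^sup>2) powr -(k - 1/2)) \<partial>lborel)"
  proof (rule nn_integral_cong)
    fix y
    have "A + (Im v0 - y)\<^sup>2 > 0" using A by (smt (verit) zero_le_power2)
    from nn_integral_quadratic_powr[OF this]
    show "(\<integral>\<^sup>+x. ennreal (((A + (Im v0 - y)\<^sup>2) + (Re v0 - x)\<^sup>2) powr -k) \<partial>lborel)
       = cauchy_const k * ennreal ((A + (Im v0 - y)\<^sup>2) powr -(k - 1/2))"
      by (simp add: mult.commute)
  qed
  also have "\<dots> = cauchy_const k * (ennreal (A powr (1/2 - (k - 1/2))) * cauchy_const (k - 1/2))"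
    by (subst nn_integral_cmult, simp, subst nn_integral_quadratic_powr[OF A]) simp
  finally show ?thesis by (simp add: mult_ac)
qed

section \<open>The tube domain and its Forelli-Rudin integral\<close>

lemma space_Leb: "space (Leb n) = PiE {..<n} (\<lambda>_. UNIV)"
  by (simp add: Leb_def space_PiM)

lemma component_measurable_Leb [measurable (raw)]:
  assumes "j < n" shows "(\<lambda>z. z j) \<in> borel_measurable (Leb n)"
proof -
  have "(\<lambda>z. z j) \<in> measurable (PiM {..<n} (\<lambda>_. lborel :: complex measure)) lborel"
    using assms by (intro measurable_component_singleton) auto
  then show ?thesis by (simp add: Leb_def)
qed

lemma rho_measurable [measurable]: "1 \<le> n \<Longrightarrow> rho n \<in> borel_measurable (Leb n)"
  unfolding rho_def
  by (intro borel_measurable_diff borel_measurable_sum borel_measurable_power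
        measurable_compose[OF component_measurable_Leb borel_measurable_Im]) auto

lemma rho2_measurable [measurable]: "1 \<le> n \<Longrightarrow> rho2 n z \<in> borel_measurable (Leb n)"
proof -
  assume n: "1 \<le> n"
  have cnj: "cnj \<in> borel_measurable borel"
    by (intro borel_measurable_continuous_onI continuous_intros)
  show ?thesis
    unfolding rho2_def using n
    by (intro borel_measurable_diff borel_measurable_sum borel_measurable_power borel_measurable_times
        borel_measurable_const measurable_compose[OF component_measurable_Leb cnj]) auto
qed

lemma TB_sets [measurable]: "1 \<le> n \<Longrightarrow> TB n \<in> sets (Leb n)"
  unfolding TB_def by (rule borel_measurable_less[OF borel_measurable_const rho_measurable])

lemma sigma_finite_Leb: "sigma_finite_measure (Leb n)"
proof -
  interpret product_sigma_finite "\<lambda>_::nat. lborel :: complex measure"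
    by unfold_locales
  show ?thesis unfolding Leb_def by (rule sigma_finite) simp
qed

lemma pair_sigma_finite_Leb: "pair_sigma_finite (Leb n) (Leb n)"
  by (intro pair_sigma_finite.intro sigma_finite_Leb)

text \<open>The real part of a square contributes (Re z_j - Re u_j)^2 - (Im z_j + Im u_j)^2. The
  parallelogram law replaces the last term by the difference (Im z_j - Im u_j)^2 and the squares
  that complete \<open>rho n z\<close> and \<open>rho n u\<close>.\<close>

lemma Re_rho2:
  "Re (rho2 n z u) = ((\<Sum>j<n - 1. (cmod (z j - u j))\<^sup>2) + 2 * rho n z + 2 * rho n u) / 4"
proof -
  have "Re ((z j - cnj (u j))\<^sup>2)
      = (cmod (z j - u j))\<^sup>2 - 2 * (Im (z j))\<^sup>2 - 2 * (Im (u j))\<^sup>2" for j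
    unfolding cmod_power2 by (simp add: power2_eq_square algebra_simps)
  then have "Re (\<Sum>j<n - 1. (z j - cnj (u j))\<^sup>2)
     = (\<Sum>j<n - 1. (cmod (z j - u j))\<^sup>2) - 2 * (\<Sum>j<n - 1. (Im (z j))\<^sup>2) - 2 * (\<Sum>j<n - 1. (Im (u j))\<^sup>2)"
    by (simp add: sum_subtractf sum_distrib_left)
  then show ?thesis by (simp add: rho2_def rho_def)
qed

text \<open>Written as \<open>Re (u (n - 1))\<close> minus a shift that involves only z and the
  first n - 1 coordinates of u, so that a translation of \<open>Re (u (n - 1))\<close> removes the
  shift.\<close>

lemma Im_rho2:
  "Im (rho2 n z u) = (Re (u (n - 1)) -
      (Re (z (n - 1)) - (\<Sum>j<n - 1. (Re (z j) - Re (u j)) * (Im (z j) + Im (u j))))) / 2"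
proof -
  have "Im ((z j - cnj (u j))\<^sup>2) = 2 * ((Re (z j) - Re (u j)) * (Im (z j) + Im (u j)))" for j
    by (simp add: power2_eq_square)
  then have "Im (\<Sum>j<n - 1. (z j - cnj (u j))\<^sup>2)
     = 2 * (\<Sum>j<n - 1. (Re (z j) - Re (u j)) * (Im (z j) + Im (u j)))"
    by (simp add: sum_distrib_left)
  then show ?thesis by (simp add: rho2_def)
qed

lemma rho_pos: "z \<in> TB n \<Longrightarrow> 0 < rho n z"
  by (simp add: TB_def)

lemma Re_rho2_ge: "(rho n z + rho n u) / 2 \<le> Re (rho2 n z u)"
proof -
  have "0 \<le> (\<Sum>j<n - 1. (cmod (z j - u j))\<^sup>2)" by (intro sum_nonneg) auto
  then show ?thesis unfolding Re_rho2 by simp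
qed

lemma Re_rho2_pos: "z \<in> TB n \<Longrightarrow> u \<in> TB n \<Longrightarrow> 0 < Re (rho2 n z u)"
  using Re_rho2_ge[of n z u] rho_pos[of z n] rho_pos[of u n] by fastforce

lemma cmod_rho2_ge: "(rho n z + rho n u) / 2 \<le> cmod (rho2 n z u)"
  using Re_rho2_ge complex_Re_le_cmod order_trans by blast

lemma cmod_rho2_pos: "z \<in> TB n \<Longrightarrow> u \<in> TB n \<Longrightarrow> 0 < cmod (rho2 n z u)"
  using Re_rho2_pos by force

text \<open>Each complex coordinate lowers the exponent by 1, in two real steps of 1/2; the
  arguments are the exponents met when coordinate j is integrated after the coordinates below
  it.\<close>

definition quadratic_const :: "nat \<Rightarrow> real \<Rightarrow> ennreal" where
  "quadratic_const m k = (\<Prod>j<m. cauchy_const (k - real j) * cauchy_const (k - real j - 1/2))"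

text \<open>The new coordinate y is kept as the outer variable. The induction hypothesis then
  applies to the inner integral with A + |z_m - y|^2 in place of A, which is why A is generalised,
  and returns an integral of the same shape in y.\<close>

lemma nn_integral_PiM_quadratic_powr:
  fixes A :: real assumes A: "A > 0"
  shows "(\<integral>\<^sup>+u. ennreal ((A + (\<Sum>j<m. (cmod (z j - u j))\<^sup>2)) powr -k) \<partial>PiM {..<m} (\<lambda>_. lborel :: complex measure))
    = ennreal (A powr (real m - k)) * quadratic_const m k"
  using A
proof (induction m arbitrary: A)
  case 0
  then show ?case by (simp add: quadratic_const_def PiM_empty)
next
  case (Suc m)
  interpret product_sigma_finite "\<lambda>_::nat. lborel :: complex measure"
    by unfold_locales
  let ?c = "cauchy_const (k - real m) * cauchy_const (k - real m - 1/2)"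
  have meas: "(\<lambda>u. ennreal ((A + (\<Sum>j<Suc m. (cmod (z j - u j))\<^sup>2)) powr -k))
      \<in> borel_measurable (PiM {..<Suc m} (\<lambda>_. lborel :: complex measure))"
  proof -
    have "(\<lambda>u. ennreal ((A + (\<Sum>j<Suc m. (cmod (z j - u j))\<^sup>2)) powr -k)) \<in> borel_measurable (Leb (Suc m))"
      by (intro measurable_compose[OF _ measurable_ennreal] powr_real_measurable borel_measurable_add
          borel_measurable_sum borel_measurable_power borel_measurable_norm borel_measurable_diff
          borel_measurable_const component_measurable_Leb) auto
    then show ?thesis by (simp add: Leb_def)
  qed
  have eq: "{..<Suc m} = insert m {..<m}" by auto
  have "(\<integral>\<^sup>+u. ennreal ((A + (\<Sum>j<Suc m. (cmod (z j - u j))\<^sup>2)) powr -k) \<partial>PiM {..<Suc m} (\<lambda>_. lborel))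
    = (\<integral>\<^sup>+y. \<integral>\<^sup>+u. ennreal ((A + (\<Sum>j<Suc m. (cmod (z j - (u(m:=y)) j))\<^sup>2)) powr -k) \<partial>PiM {..<m} (\<lambda>_. lborel) \<partial>lborel)"
    using meas unfolding eq by (subst product_nn_integral_insert_rev) auto
  also have "\<dots> = (\<integral>\<^sup>+y. quadratic_const m k * ennreal ((A + (cmod (z m - y))\<^sup>2) powr -(k - real m)) \<partial>lborel)"
  proof (rule nn_integral_cong)
    fix y
    have pos: "A + (cmod (z m - y))\<^sup>2 > 0" using Suc.prems by (smt (verit) zero_le_power2)
    have "A + (\<Sum>j<Suc m. (cmod (z j - (u(m:=y)) j))\<^sup>2) = (A + (cmod (z m - y))\<^sup>2) + (\<Sum>j<m. (cmod (z j - u j))\<^sup>2)" for u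
    proof -
      have "(\<Sum>j<m. (cmod (z j - (u(m:=y)) j))\<^sup>2) = (\<Sum>j<m. (cmod (z j - u j))\<^sup>2)"
        by (intro sum.cong) auto
      then show ?thesis by simp
    qed
    then show "(\<integral>\<^sup>+u. ennreal ((A + (\<Sum>j<Suc m. (cmod (z j - (u(m:=y)) j))\<^sup>2)) powr -k) \<partial>PiM {..<m} (\<lambda>_. lborel))
        = quadratic_const m k * ennreal ((A + (cmod (z m - y))\<^sup>2) powr -(k - real m))"
      using Suc.IH[OF pos] by (simp add: mult.commute add_ac)
  qed
  also have "\<dots> = quadratic_const m k * (ennreal (A powr (1 - (k - real m))) * ?c)"
    by (subst nn_integral_cmult, simp, subst nn_integral_complex_quadratic_powr[OF Suc.prems]) simp
  also have "\<dots> = ennreal (A powr (real (Suc m) - k)) * quadratic_const (Suc m) k"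
    by (simp add: quadratic_const_def mult_ac add_ac algebra_simps)
  finally show ?case .
qed

lemma quadratic_const_pos: "quadratic_const m k > 0"
  using cauchy_const_pos by (auto simp: quadratic_const_def zero_less_iff_neq_zero)

text \<open>No factor is 0, so one infinite factor makes the product infinite. The pair with index j
  is finite iff k > j + 1, and j = m - 1 is the strongest condition; for m = 0 the product is empty
  and finite for all k.\<close>

lemma quadratic_const_finite: "quadratic_const m k < \<infinity> \<longleftrightarrow> m = 0 \<or> k > real m"
proof -
  have nz: "cauchy_const x \<noteq> 0" for x using cauchy_const_pos[of x] by simp
  have fin: "cauchy_const x \<noteq> top \<longleftrightarrow> x > 1/2" for x
    using cauchy_const_finite[of x] by (simp add: top.not_eq_extremum)
  have "quadratic_const m k < \<infinity> \<longleftrightarrow> (\<forall>j<m. k > real j + 1)"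
  proof -
    have "quadratic_const m k = top \<longleftrightarrow> (\<exists>j<m. \<not> k > real j + 1)"
      unfolding quadratic_const_def
    proof (induction m)
      case (Suc m)
      have "(\<Prod>j<m. cauchy_const (k - real j) * cauchy_const (k - real j - 1/2)) \<noteq> 0"
        using nz by simp
      moreover have "cauchy_const (k - real m) * cauchy_const (k - real m - 1/2) = top \<longleftrightarrow> \<not> k > real m + 1"
        using fin[of "k - real m"] fin[of "k - real m - 1/2"] nz
        by (auto simp: ennreal_mult_eq_top_iff)
      ultimately show ?case using Suc nz
        by (simp add: ennreal_mult_eq_top_iff less_Suc_eq) blast
    qed simp
    then show ?thesis by (auto simp: less_top)
  qed
  also have "\<dots> \<longleftrightarrow> m = 0 \<or> k > real m"
  proof (cases m)
    case (Suc l)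
    then show ?thesis by (fastforce simp: less_Suc_eq_le)
  qed simp
  finally show ?thesis .
qed

text \<open>\<open>FR\<close> stands for Forelli-Rudin. The factors come from integrating \<open>rho\<^sup>s |rho2|\<^sup>-\<^sup>t\<close>
  successively over \<open>Re u\<^sub>n\<close>, \<open>Im u\<^sub>n\<close> and the remaining \<open>n - 1\<close> coordinates.\<close>

definition FR_const :: "nat \<Rightarrow> real \<Rightarrow> real \<Rightarrow> ennreal" where
  "FR_const n s t = ennreal (2 powr t * 2 powr (t - 1) * 2 powr (real n + 1 + s - t)) *
     (cauchy_const (t/2) * (beta_const s (t - 1) * quadratic_const (n - 1) (t - s - 2)))"

lemma FR_const_pos: "FR_const n s t > 0"
  using cauchy_const_pos[of "t/2"] beta_const_pos[of s "t-1"] quadratic_const_pos[of "n-1" "t-s-2"]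
  by (auto simp: FR_const_def zero_less_iff_neq_zero)

text \<open>For n = 1 the bound on t is that of \<open>beta_const\<close>, namely t - 1 > s + 1; for
  n \<ge> 2 it is that of \<open>quadratic_const\<close>. With s > -1 the remaining requirements
  follow.\<close>

lemma FR_const_finite:
  assumes "1 \<le> n" shows "FR_const n s t < \<infinity> \<longleftrightarrow> s > -1 \<and> t > real n + 1 + s"
proof -
  have pos: "cauchy_const (t/2) \<noteq> 0" "beta_const s (t-1) \<noteq> 0" "quadratic_const (n-1) (t-s-2) \<noteq> 0"
    using cauchy_const_pos[of "t/2"] beta_const_pos[of s "t-1"] quadratic_const_pos[of "n-1" "t-s-2"] by auto
  have "FR_const n s t < \<infinity> \<longleftrightarrow> cauchy_const (t/2) < \<infinity> \<and> beta_const s (t-1) < \<infinity> \<and> quadratic_const (n-1) (t-s-2) < \<infinity>"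
    using pos by (auto simp: FR_const_def ennreal_mult_eq_top_iff less_top[symmetric])
  also have "\<dots> \<longleftrightarrow> s > -1 \<and> t > real n + 1 + s"
    unfolding cauchy_const_finite beta_const_finite quadratic_const_finite
    using assms by (auto simp: of_nat_diff)
  finally show ?thesis .
qed

text \<open>An equality in \<open>ennreal\<close> for all s and t: finiteness of the constant gives
  sufficiency, and the exact power of \<open>rho n z\<close> gives necessity.\<close>

lemma nn_integral_TB_rho_powr:
  assumes n: "1 \<le> n" and z: "z \<in> TB n"
  shows "(\<integral>\<^sup>+u. ennreal (rho n u powr s * cmod (rho2 n z u) powr -t) * indicator (TB n) u \<partial>Leb n)
     = FR_const n s t * ennreal (rho n z powr (real n + 1 + s - t))"
proof -
  interpret product_sigma_finite "\<lambda>_::nat. lborel :: complex measure"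
    by unfold_locales
  define m where "m = n - 1"
  have nm: "n = Suc m" using n by (simp add: m_def)
  define F where "F = (\<lambda>u. ennreal (rho n u powr s * cmod (rho2 n z u) powr -t) * indicator (TB n) u)"
  have "F \<in> borel_measurable (Leb n)"
    unfolding F_def using n by measurable
  then have F: "F \<in> borel_measurable (PiM (insert m {..<m}) (\<lambda>_. lborel))"
    unfolding Leb_def nm by (simp add: lessThan_Suc)
  \<comment> \<open>With the first n - 1 coordinates x fixed, B is the lower limit for the imaginary
    part of the last coordinate, A + 2 (Im v - B) is four times the real part of
    \<open>rho2\<close>, and S is the centre of symmetry in Re v.\<close>
  define B where "B = (\<lambda>x::nat \<Rightarrow> complex. \<Sum>j<m. (Im (x j))\<^sup>2)"
  define A where "A = (\<lambda>x. 2 * rho n z + (\<Sum>j<m. (cmod (z j - x j))\<^sup>2))"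
  define S where "S = (\<lambda>x. Re (z m) - (\<Sum>j<m. (Re (z j) - Re (x j)) * (Im (z j) + Im (x j))))"
  have A: "A x > 0" for x
    using rho_pos[OF z] unfolding A_def by (intro add_pos_nonneg sum_nonneg) auto
  have rho_eq: "rho n (x(m:=v)) = Im v - B x" for x v
    by (simp add: rho_def nm B_def)
  \<comment> \<open>Origin of the powers of 2 in \<open>FR_const\<close>: 2^t from the factor 1/4 in
    the squared modulus here, 2^(t-1) from X^2/4 after integration over Re v, and the third from the
    value 2 \<open>rho n z\<close> that remains at the end.\<close>
  have cmod_eq: "cmod (rho2 n z (x(m:=v))) powr -t
      = 2 powr t * (((A x + 2 * (Im v - B x))\<^sup>2 / 4 + (S x - Re v)\<^sup>2) powr -(t/2))"
    if "Im v > B x" for x v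
  proof -
    let ?X = "A x + 2 * (Im v - B x)"
    have X: "?X > 0" using A[of x] that by simp
    have Re: "Re (rho2 n z (x(m:=v))) = ?X / 4"
      unfolding Re_rho2 rho_eq by (simp add: nm A_def algebra_simps)
    have Im: "Im (rho2 n z (x(m:=v))) = (Re v - S x) / 2"
      unfolding Im_rho2 by (simp add: nm S_def)
    have pos: "?X\<^sup>2 / 4 + (S x - Re v)\<^sup>2 > 0" using X by (intro add_pos_nonneg) auto
    have "(cmod (rho2 n z (x(m:=v))))\<^sup>2 = (1/4) * (?X\<^sup>2 / 4 + (S x - Re v)\<^sup>2)"
      unfolding cmod_power2 Re Im by (simp add: power2_eq_square field_simps)
    then have "cmod (rho2 n z (x(m:=v))) = ((1/4) * (?X\<^sup>2 / 4 + (S x - Re v)\<^sup>2)) powr (1/2)"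
      using pos by (metis norm_ge_zero powr_half_sqrt real_sqrt_abs abs_norm_cancel zero_le_power2)
    then have "cmod (rho2 n z (x(m:=v))) powr -t = ((1/4) * (?X\<^sup>2 / 4 + (S x - Re v)\<^sup>2)) powr -(t/2)"
      by (simp add: powr_powr)
    also have "\<dots> = (1/4) powr -(t/2) * (?X\<^sup>2 / 4 + (S x - Re v)\<^sup>2) powr -(t/2)"
      using pos by (subst powr_mult) auto
    also have "(1/4::real) powr -(t/2) = 2 powr t"
    proof -
      have "(1/4::real) = 2 powr -2" by (simp add: powr_minus_divide)
      then show ?thesis by (simp only: powr_powr) simp
    qed
    finally show ?thesis .
  qed
  have inner: "(\<integral>\<^sup>+v. F (x(m:=v)) \<partial>lborel)
      = ennreal (2 powr t * 2 powr (t - 1)) * (cauchy_const (t/2) * beta_const s (t - 1))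
         * ennreal (A x powr -(t - s - 2))" (is "?L = ?R")
    if x: "x \<in> space (PiM {..<m} (\<lambda>_. lborel :: complex measure))" for x
  proof -
    have TB_eq: "x(m:=v) \<in> TB n \<longleftrightarrow> Im v > B x" for v
      using x unfolding TB_def rho_eq mem_Collect_eq by (auto simp: space_Leb space_PiM nm PiE_iff extensional_def)
    let ?G = "\<lambda>\<tau> \<sigma>. ennreal (2 powr t * (\<tau> - B x) powr s) * indicator {B x<..} \<tau> *
        ennreal (((A x + 2 * (\<tau> - B x))\<^sup>2 / 4 + (S x - \<sigma>)\<^sup>2) powr -(t/2))"
    have F_eq: "F (x(m:=v)) = ?G (Im v) (Re v)" for v
      by (cases "Im v > B x") (auto simp: F_def rho_eq cmod_eq TB_eq ennreal_mult[symmetric] mult_ac)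
    have "?L = (\<integral>\<^sup>+\<tau>. \<integral>\<^sup>+\<sigma>. ?G \<tau> \<sigma> \<partial>lborel \<partial>lborel)"
      unfolding F_eq by (subst nn_integral_lborel_complex) auto
    also have "\<dots> = (\<integral>\<^sup>+\<tau>. ennreal (2 powr t * 2 powr (t - 1)) * cauchy_const (t/2) *
       (ennreal ((\<tau> - B x) powr s * (A x + 2 * (\<tau> - B x)) powr -(t - 1)) * indicator {B x<..} \<tau>) \<partial>lborel)"
    proof (rule nn_integral_cong)
      fix \<tau>
      show "(\<integral>\<^sup>+\<sigma>. ?G \<tau> \<sigma> \<partial>lborel) = ennreal (2 powr t * 2 powr (t - 1)) * cauchy_const (t/2) *
       (ennreal ((\<tau> - B x) powr s * (A x + 2 * (\<tau> - B x)) powr -(t - 1)) * indicator {B x<..} \<tau>)"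
      proof (cases "\<tau> > B x")
        case True
        let ?X = "A x + 2 * (\<tau> - B x)"
        have X: "?X > 0" using A[of x] True by simp
        have p: "(?X\<^sup>2 / 4) powr (1/2 - t/2) = 2 powr (t - 1) * ?X powr -(t - 1)"
        proof -
          have "?X\<^sup>2 / 4 = (?X / 2) powr 2" using X by (simp add: power_divide)
          then have "(?X\<^sup>2 / 4) powr (1/2 - t/2) = (?X / 2) powr (2 * (1/2 - t/2))"
            by (simp only: powr_powr)
          also have "2 * (1/2 - t/2) = -(t - 1)" by simp
          also have "(?X / 2) powr -(t - 1) = ?X powr -(t - 1) / 2 powr -(t - 1)"
            using X by (subst powr_divide) auto
          also have "\<dots> = 2 powr (t - 1) * ?X powr -(t - 1)"
            using powr_minus_divide[of 2 "t - 1"] by (simp add: field_simps)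
          finally show ?thesis .
        qed
        have "(\<integral>\<^sup>+\<sigma>. ?G \<tau> \<sigma> \<partial>lborel) = ennreal (2 powr t * (\<tau> - B x) powr s) *
             (ennreal ((?X\<^sup>2 / 4) powr (1/2 - t/2)) * cauchy_const (t/2))"
          using True X by (subst nn_integral_cmult, simp, subst nn_integral_quadratic_powr) auto
        also have "\<dots> = ennreal (2 powr t * 2 powr (t - 1)) * cauchy_const (t/2) *
           (ennreal ((\<tau> - B x) powr s * ?X powr -(t - 1)))"
          unfolding p by (simp add: ennreal_mult mult_ac)
        finally show ?thesis using True by simp
      qed simp
    qed
    also have "\<dots> = ennreal (2 powr t * 2 powr (t - 1)) * cauchy_const (t/2) *
        (ennreal (A x powr (s + 1 - (t - 1))) * beta_const s (t - 1))"
      by (subst nn_integral_cmult, simp, subst nn_integral_beta_powr[OF A]) simp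
    finally show ?thesis by (simp add: mult_ac algebra_simps)
  qed
  have "(\<integral>\<^sup>+u. F u \<partial>Leb n) = (\<integral>\<^sup>+x. \<integral>\<^sup>+v. F (x(m:=v)) \<partial>lborel \<partial>PiM {..<m} (\<lambda>_. lborel))"
    using F unfolding Leb_def nm lessThan_Suc by (subst product_nn_integral_insert) auto
  also have "\<dots> = (\<integral>\<^sup>+x. ennreal (2 powr t * 2 powr (t - 1)) * (cauchy_const (t/2) * beta_const s (t - 1))
         * ennreal (A x powr -(t - s - 2)) \<partial>PiM {..<m} (\<lambda>_. lborel))"
    using inner by (rule nn_integral_cong)
  also have "\<dots> = ennreal (2 powr t * 2 powr (t - 1)) * (cauchy_const (t/2) * beta_const s (t - 1))
         * (\<integral>\<^sup>+x. ennreal (A x powr -(t - s - 2)) \<partial>PiM {..<m} (\<lambda>_. lborel))"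
  proof (rule nn_integral_cmult)
    have "(\<lambda>x. ennreal (A x powr -(t - s - 2))) \<in> borel_measurable (Leb m)"
      unfolding A_def
      by (intro measurable_compose[OF _ measurable_ennreal] powr_real_measurable borel_measurable_add
          borel_measurable_sum borel_measurable_power borel_measurable_norm borel_measurable_diff
          borel_measurable_const component_measurable_Leb) auto
    then show "(\<lambda>x. ennreal (A x powr -(t - s - 2))) \<in> borel_measurable (PiM {..<m} (\<lambda>_. lborel))"
      by (simp add: Leb_def)
  qed
  also have "(\<integral>\<^sup>+x. ennreal (A x powr -(t - s - 2)) \<partial>PiM {..<m} (\<lambda>_. lborel))
     = ennreal ((2 * rho n z) powr (real m - (t - s - 2))) * quadratic_const m (t - s - 2)"
    unfolding A_def using rho_pos[OF z] by (subst nn_integral_PiM_quadratic_powr) auto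
  also have "(2 * rho n z) powr (real m - (t - s - 2))
      = 2 powr (real n + 1 + s - t) * rho n z powr (real n + 1 + s - t)"
    using rho_pos[OF z] by (subst powr_mult) (auto simp: nm algebra_simps)
  finally show ?thesis
    unfolding F_def by (simp add: FR_const_def nm ennreal_mult mult_ac)
qed

section \<open>Sufficiency\<close>

lemma enn_root_measurable [measurable]: "enn_root p \<in> borel_measurable borel"
  unfolding enn_root_def[abs_def] by measurable

lemma enn_root_ennreal: "0 \<le> x \<Longrightarrow> enn_root p (ennreal x) = ennreal (x powr (1/p))"
  by (simp add: enn_root_def)

lemma enn_root_eq_top_iff [simp]: "enn_root p x = top \<longleftrightarrow> x = top"
  by (simp add: enn_root_def)

lemma enn_root_eq_0_iff: "enn_root p x = 0 \<longleftrightarrow> x = 0"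
  by (auto simp: enn_root_def enn2real_eq_0_iff)

text \<open>Young's inequality for f/a and g/b, where a and b are the two norms. A vanishing norm is
  treated apart: it makes the left side 0 even if the other norm is infinite, in accordance with 0 *
  top = 0.\<close>

lemma nn_integral_Hoelder:
  fixes f g :: "'a \<Rightarrow> real"
  assumes [measurable]: "f \<in> borel_measurable M" "g \<in> borel_measurable M"
    and nonneg: "\<And>x. 0 \<le> f x" "\<And>x. 0 \<le> g x"
    and pq: "p > 1" "q > 1" "1/p + 1/q = 1"
  shows "(\<integral>\<^sup>+x. ennreal (f x * g x) \<partial>M)
     \<le> enn_root q (\<integral>\<^sup>+x. ennreal (f x powr q) \<partial>M) * enn_root p (\<integral>\<^sup>+x. ennreal (g x powr p) \<partial>M)"
    (is "?I \<le> enn_root q ?F * enn_root p ?G")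
proof -
  have zero: "?I = 0" if "?F = 0 \<or> ?G = 0"
  proof -
    have "AE x in M. f x = 0 \<or> g x = 0"
      using that by (auto simp: nn_integral_0_iff_AE ennreal_eq_0_iff elim: eventually_mono)
    then show ?thesis by (subst nn_integral_0_iff_AE) (auto elim: eventually_mono)
  qed
  consider "?F = 0 \<or> ?G = 0" | "?F \<noteq> 0" "?G \<noteq> 0" "?F = top \<or> ?G = top"
    | "?F \<noteq> 0" "?G \<noteq> 0" "?F \<noteq> top" "?G \<noteq> top" by blast
  then show ?thesis
  proof cases
    case 1 then show ?thesis using zero by simp
  next
    case 2
    then have "enn_root q ?F * enn_root p ?G = top"
      by (auto simp: ennreal_mult_eq_top_iff enn_root_eq_0_iff)
    then show ?thesis by simp
  next
    case 3
    obtain F where F: "?F = ennreal F" "F > 0"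
      using 3 by (cases ?F) (auto simp: le_less)
    obtain G where G: "?G = ennreal G" "G > 0"
      using 3 by (cases ?G) (auto simp: le_less)
    define a where "a = F powr (1/q)"
    define b where "b = G powr (1/p)"
    have ab: "a > 0" "b > 0" using F G by (auto simp: a_def b_def)
    have aq: "a powr q = F" "b powr p = G" using F G pq by (auto simp: a_def b_def powr_powr)
    have le: "f x * g x \<le> (a*b/(F*q)) * f x powr q + (a*b/(G*p)) * g x powr p" for x
    proof -
      have "(f x / a) * (g x / b) \<le> (f x / a) powr q / q + (g x / b) powr p / p"
        using pq ab nonneg by (intro Youngs_inequality) (auto simp: add.commute)
      also have "\<dots> = f x powr q / (F*q) + g x powr p / (G*p)"
        using ab nonneg aq by (simp add: powr_divide)
      finally have "f x * g x / (a*b) \<le> f x powr q / (F*q) + g x powr p / (G*p)" by simp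
      then have "f x * g x \<le> (f x powr q / (F*q) + g x powr p / (G*p)) * (a*b)"
        using ab by (subst (asm) pos_divide_le_eq) auto
      then show ?thesis by (simp add: algebra_simps)
    qed
    have "?I \<le> (\<integral>\<^sup>+x. ennreal (a*b/(F*q)) * ennreal (f x powr q) + ennreal (a*b/(G*p)) * ennreal (g x powr p) \<partial>M)"
    proof (rule nn_integral_mono)
      fix x
      show "ennreal (f x * g x) \<le> ennreal (a*b/(F*q)) * ennreal (f x powr q) + ennreal (a*b/(G*p)) * ennreal (g x powr p)"
        using ennreal_leI[OF le[of x]] ab F G pq
        by (simp add: ennreal_plus ennreal_mult[symmetric] divide_nonneg_nonneg mult_nonneg_nonneg less_imp_le)
    qed
    also have "\<dots> = ennreal (a*b/(F*q)) * ?F + ennreal (a*b/(G*p)) * ?G"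
      by (subst nn_integral_add) (auto simp: nn_integral_cmult)
    also have "\<dots> = ennreal ((a*b/(F*q)) * F + (a*b/(G*p)) * G)"
      unfolding F G using ab F G pq
      by (simp add: ennreal_plus ennreal_mult[symmetric] divide_nonneg_nonneg mult_nonneg_nonneg less_imp_le)
    also have "(a*b/(F*q)) * F + (a*b/(G*p)) * G = a * b * (1/p + 1/q)"
      using F G by (simp add: field_simps)
    also have "\<dots> = a * b" using pq by simp
    also have "ennreal (a * b) = enn_root q ?F * enn_root p ?G"
      using F G ab by (simp add: enn_root_ennreal a_def b_def ennreal_mult)
    finally show ?thesis .
  qed
qed

section \<open>The one-variable kernel: norms and pointwise bound\<close>

text \<open>The modulus of either kernel is a product of two of these, one for each variable; the
  two kernels differ only by a phase.\<close>

definition weight_kernel :: "nat \<Rightarrow> real \<Rightarrow> real \<Rightarrow> real \<Rightarrow> (nat \<Rightarrow> complex) \<Rightarrow> (nat \<Rightarrow> complex) \<Rightarrow> real" where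
  "weight_kernel n a b c z u = rho n z powr a * rho n u powr b * cmod (rho2 n z u) powr -c"

lemma weight_kernel_nonneg: "0 \<le> weight_kernel n a b c z u"
  by (simp add: weight_kernel_def)

lemma weight_kernel_pos: "z \<in> TB n \<Longrightarrow> u \<in> TB n \<Longrightarrow> 0 < weight_kernel n a b c z u"
  using rho_pos[of z n] rho_pos[of u n] cmod_rho2_pos[of z n u] by (auto simp: weight_kernel_def)

lemma weight_kernel_measurable [measurable]:
  "1 \<le> n \<Longrightarrow> weight_kernel n a b c z \<in> borel_measurable (Leb n)"
  unfolding weight_kernel_def by measurable

text \<open>The weight of the space is split off as rho^(\<alpha>/p) on the function and
  rho^(-\<alpha>/p) on the kernel, so that duality is taken with respect to unweighted measure.
  Since q/p = q - 1, the exponent of \<open>rho n u\<close> becomes q(b-\<alpha>) +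
  \<alpha>.\<close>

lemma weight_kernel_powr_q:
  assumes z: "z \<in> TB n" and u: "u \<in> TB n" and pq: "p > 1" "q > 1" "1/p + 1/q = 1"
  shows "(weight_kernel n a b c z u * rho n u powr -(\<alpha>/p)) powr q
     = rho n z powr (a*q) * (rho n u powr (q*(b-\<alpha>) + \<alpha>) * cmod (rho2 n z u) powr -(c*q))"
proof -
  have qp: "q/p = q - 1" using pq by (simp add: field_simps)
  have "\<alpha>/p*q = \<alpha>*(q/p)" by simp
  then have e: "b*q + - (\<alpha>/p*q) = q*(b-\<alpha>) + \<alpha>"
    unfolding qp by (simp add: algebra_simps)
  show ?thesis
    using rho_pos[OF z] rho_pos[OF u] cmod_rho2_pos[OF z u]
    by (simp add: weight_kernel_def powr_mult powr_powr flip: e powr_add)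
qed

lemma weight_kernel_Lq_norm:
  assumes n: "1 \<le> n" and z: "z \<in> TB n" and pq: "p > 1" "q > 1" "1/p + 1/q = 1"
    and s: "s = q*(b-\<alpha>) + \<alpha>"
  shows "(\<integral>\<^sup>+u. ennreal ((indicator (TB n) u * (weight_kernel n a b c z u * rho n u powr -(\<alpha>/p))) powr q) \<partial>Leb n)
     = FR_const n s (c*q) * ennreal (rho n z powr (a*q + real n + 1 + s - c*q))"
proof -
  have "(\<integral>\<^sup>+u. ennreal ((indicator (TB n) u * (weight_kernel n a b c z u * rho n u powr -(\<alpha>/p))) powr q) \<partial>Leb n)
    = (\<integral>\<^sup>+u. ennreal (rho n z powr (a*q)) * (ennreal (rho n u powr s * cmod (rho2 n z u) powr -(c*q)) * indicator (TB n) u) \<partial>Leb n)"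
  proof (rule nn_integral_cong)
    fix u
    show "ennreal ((indicator (TB n) u * (weight_kernel n a b c z u * rho n u powr -(\<alpha>/p))) powr q)
     = ennreal (rho n z powr (a*q)) * (ennreal (rho n u powr s * cmod (rho2 n z u) powr -(c*q)) * indicator (TB n) u)"
    proof (cases "u \<in> TB n")
      case True
      then show ?thesis
        by (simp only: indicator_simps mult_1 mult_1_right weight_kernel_powr_q[OF z _ pq] s
            ennreal_mult powr_ge_zero mult_nonneg_nonneg)
    qed simp
  qed
  also have "\<dots> = ennreal (rho n z powr (a*q)) * (FR_const n s (c*q) * ennreal (rho n z powr (real n + 1 + s - c*q)))"
    using n by (subst nn_integral_cmult) (auto simp: nn_integral_TB_rho_powr[OF n z])
  also have "\<dots> = FR_const n s (c*q) * ennreal (rho n z powr (a*q) * rho n z powr (real n + 1 + s - c*q))"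
    by (simp add: ennreal_mult mult_ac)
  also have "rho n z powr (a*q) * rho n z powr (real n + 1 + s - c*q) = rho n z powr (a*q + real n + 1 + s - c*q)"
    by (simp flip: powr_add add: algebra_simps)
  finally show ?thesis .
qed

text \<open>By \<open>hom\<close> the power of \<open>rho n z\<close> in the L^q norm of the kernel
  has exponent 0, so the bound is uniform in z.\<close>

lemma weight_kernel_Hoelder:
  fixes g :: "(nat \<Rightarrow> complex) \<Rightarrow> real"
  assumes n: "1 \<le> n" and z: "z \<in> TB n" and pq: "p > 1" "q > 1" "1/p + 1/q = 1"
    and s: "s = q*(b-\<alpha>) + \<alpha>" and hom: "a*q + real n + 1 + s - c*q = 0"
    and [measurable]: "g \<in> borel_measurable (Leb n)" and g0: "\<And>u. 0 \<le> g u"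
  shows "(\<integral>\<^sup>+u. indicator (TB n) u * ennreal (weight_kernel n a b c z u * g u) \<partial>Leb n)
     \<le> enn_root q (FR_const n s (c*q)) * enn_root p (\<integral>\<^sup>+u. indicator (TB n) u * ennreal (g u powr p * rho n u powr \<alpha>) \<partial>Leb n)"
proof -
  note [measurable] = rho_measurable[OF n] weight_kernel_measurable[OF n] TB_sets[OF n]
  let ?f1 = "\<lambda>u. indicator (TB n) u * (weight_kernel n a b c z u * rho n u powr -(\<alpha>/p))"
  let ?f2 = "\<lambda>u. indicator (TB n) u * (g u * rho n u powr (\<alpha>/p))"
  have "(\<integral>\<^sup>+u. indicator (TB n) u * ennreal (weight_kernel n a b c z u * g u) \<partial>Leb n)
     = (\<integral>\<^sup>+u. ennreal (?f1 u * ?f2 u) \<partial>Leb n)"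
  proof (rule nn_integral_cong)
    fix u
    have "rho n u powr -(\<alpha>/p) * rho n u powr (\<alpha>/p) = 1" if "u \<in> TB n"
      using rho_pos[OF that] by (simp flip: powr_add)
    then show "indicator (TB n) u * ennreal (weight_kernel n a b c z u * g u) = ennreal (?f1 u * ?f2 u)"
      by (cases "u \<in> TB n") (simp_all add: mult_ac)
  qed
  also have "\<dots> \<le> enn_root q (\<integral>\<^sup>+u. ennreal (?f1 u powr q) \<partial>Leb n) * enn_root p (\<integral>\<^sup>+u. ennreal (?f2 u powr p) \<partial>Leb n)"
    by (rule nn_integral_Hoelder) (use pq g0 in \<open>auto simp: weight_kernel_nonneg intro!: mult_nonneg_nonneg\<close>)
  also have "(\<integral>\<^sup>+u. ennreal (?f1 u powr q) \<partial>Leb n) = FR_const n s (c*q)"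
    using rho_pos[OF z] by (subst weight_kernel_Lq_norm[OF n z pq s]) (simp add: hom)
  also have "(\<integral>\<^sup>+u. ennreal (?f2 u powr p) \<partial>Leb n) = (\<integral>\<^sup>+u. indicator (TB n) u * ennreal (g u powr p * rho n u powr \<alpha>) \<partial>Leb n)"
  proof (rule nn_integral_cong)
    fix u
    show "ennreal (?f2 u powr p) = indicator (TB n) u * ennreal (g u powr p * rho n u powr \<alpha>)"
      using g0[of u] pq by (cases "u \<in> TB n") (auto simp: powr_mult powr_powr)
  qed
  finally show ?thesis .
qed

text \<open>All three factors are compared with powers of r = \<open>rho n w + rho n \<eta>\<close>.
  The signs of a, b - \<alpha> and hence c make each comparison go the right way, and c = a + b -
  \<alpha> makes the powers of r cancel.\<close>

lemma weight_kernel_le: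
  assumes w: "w \<in> TB n" and \<eta>: "\<eta> \<in> TB n" and "0 \<le> a" "\<alpha> \<le> b" and c: "c = a + b - \<alpha>"
  shows "weight_kernel n a b c w \<eta> \<le> 2 powr c * rho n \<eta> powr \<alpha>"
proof -
  let ?r = "rho n w + rho n \<eta>"
  have pos: "rho n w > 0" "rho n \<eta> > 0" using rho_pos w \<eta> by auto
  have "cmod (rho2 n w \<eta>) powr -c \<le> (?r/2) powr -c"
    using pos cmod_rho2_ge[of n w \<eta>] assms by (intro powr_mono2') auto
  also have "\<dots> = 2 powr c * ?r powr -c"
    using pos by (simp add: powr_divide powr_minus field_simps)
  finally have k: "cmod (rho2 n w \<eta>) powr -c \<le> 2 powr c * ?r powr -c" .
  have "rho n w powr a * rho n \<eta> powr b = (rho n w powr a * rho n \<eta> powr (b-\<alpha>)) * rho n \<eta> powr \<alpha>"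
    by (simp flip: powr_add)
  also have "\<dots> \<le> (?r powr a * ?r powr (b-\<alpha>)) * rho n \<eta> powr \<alpha>"
    using pos assms by (intro mult_right_mono mult_mono powr_mono2) auto
  also have "?r powr a * ?r powr (b-\<alpha>) = ?r powr c" by (simp flip: powr_add add: c add_diff_eq)
  finally have "rho n w powr a * rho n \<eta> powr b \<le> ?r powr c * rho n \<eta> powr \<alpha>" .
  then have "weight_kernel n a b c w \<eta> \<le> (?r powr c * rho n \<eta> powr \<alpha>) * (2 powr c * ?r powr -c)"
    unfolding weight_kernel_def using k by (rule mult_mono) auto
  also have "\<dots> = 2 powr c * rho n \<eta> powr \<alpha>"
    using pos by (simp add: powr_minus field_simps)
  finally show ?thesis .
qed

section \<open>Kernels with the prescribed modulus\<close>

text \<open>Collects what the criterion needs from \<open>Sker\<close> and \<open>Tker\<close>, so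
  that it is proved once. The indicator in \<open>K_measurable\<close> confines the principal power
  to the right half-plane, away from its branch cut; \<open>K_tendsto\<close> is pointwise in
  \<open>(u, \<eta>)\<close>, as dominated convergence asks.\<close>

locale TB_kernel =
  fixes n :: nat and a b c :: "real \<times> real"
    and K :: "(nat \<Rightarrow> complex) \<Rightarrow> (nat \<Rightarrow> complex) \<Rightarrow> (nat \<Rightarrow> complex) \<Rightarrow> (nat \<Rightarrow> complex) \<Rightarrow> complex"
  assumes n: "1 \<le> n"
    and cmod_K: "\<And>z w u \<eta>. z \<in> TB n \<Longrightarrow> w \<in> TB n \<Longrightarrow> u \<in> TB n \<Longrightarrow> \<eta> \<in> TB n \<Longrightarrow>
       cmod (K z w u \<eta>) = weight_kernel n (fst a) (fst b) (fst c) z u * weight_kernel n (snd a) (snd b) (snd c) w \<eta>"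
    and K_measurable: "\<And>z w. z \<in> TB n \<Longrightarrow> w \<in> TB n \<Longrightarrow>
       (\<lambda>p. indicator (TB n \<times> TB n) p *\<^sub>R K z w (fst p) (snd p)) \<in> borel_measurable (Leb n \<Otimes>\<^sub>M Leb n)"
    and K_tendsto: "\<And>zs ws z w u \<eta>. (\<And>k::nat. zs k \<in> TB n) \<Longrightarrow> (\<And>k. ws k \<in> TB n) \<Longrightarrow>
       z \<in> TB n \<Longrightarrow> w \<in> TB n \<Longrightarrow> u \<in> TB n \<Longrightarrow> \<eta> \<in> TB n \<Longrightarrow>
       (\<And>j. j < n \<Longrightarrow> (\<lambda>k. zs k j) \<longlonglongrightarrow> z j) \<Longrightarrow> (\<And>j. j < n \<Longrightarrow> (\<lambda>k. ws k j) \<longlonglongrightarrow> w j) \<Longrightarrow>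
       (\<lambda>k. K (zs k) (ws k) u \<eta>) \<longlonglongrightarrow> K z w u \<eta>"
begin

lemma integrand_measurable:
  assumes "z \<in> TB n" "w \<in> TB n" and [measurable]: "f \<in> borel_measurable (Leb n \<Otimes>\<^sub>M Leb n)"
  shows "(\<lambda>(u, \<eta>). indicator (TB n \<times> TB n) (u, \<eta>) *\<^sub>R (K z w u \<eta> * f (u, \<eta>))) \<in> borel_measurable (Leb n \<Otimes>\<^sub>M Leb n)"
proof -
  note [measurable] = K_measurable[OF assms(1,2)]
  have "(\<lambda>p. (indicator (TB n \<times> TB n) p *\<^sub>R K z w (fst p) (snd p)) * f p) \<in> borel_measurable (Leb n \<Otimes>\<^sub>M Leb n)"
    by measurable
  then show ?thesis by (simp add: split_beta')
qed

text \<open>Tonelli with u innermost, the order of integration in \<open>mixnorm\<close>: an L^p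
  estimate inside and an L^1 estimate outside.\<close>

lemma nn_integral_cmod_integrand:
  assumes z: "z \<in> TB n" and w: "w \<in> TB n" and f[measurable]: "f \<in> borel_measurable (Leb n \<Otimes>\<^sub>M Leb n)"
  shows "(\<integral>\<^sup>+p. ennreal (cmod (case p of (u, \<eta>) \<Rightarrow> indicator (TB n \<times> TB n) (u, \<eta>) *\<^sub>R (K z w u \<eta> * f (u, \<eta>)))) \<partial>(Leb n \<Otimes>\<^sub>M Leb n))
    = (\<integral>\<^sup>+\<eta>. indicator (TB n) \<eta> * (ennreal (weight_kernel n (snd a) (snd b) (snd c) w \<eta>) *
        (\<integral>\<^sup>+u. indicator (TB n) u * ennreal (weight_kernel n (fst a) (fst b) (fst c) z u * cmod (f (u, \<eta>))) \<partial>Leb n)) \<partial>Leb n)"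
proof -
  interpret pair_sigma_finite "Leb n" "Leb n" by (rule pair_sigma_finite_Leb)
  note [measurable] = integrand_measurable[OF z w f]
  note [measurable] = rho_measurable[OF n] weight_kernel_measurable[OF n] TB_sets[OF n]
  have "(\<integral>\<^sup>+p. ennreal (cmod (case p of (u, \<eta>) \<Rightarrow> indicator (TB n \<times> TB n) (u, \<eta>) *\<^sub>R (K z w u \<eta> * f (u, \<eta>)))) \<partial>(Leb n \<Otimes>\<^sub>M Leb n))
    = (\<integral>\<^sup>+\<eta>. \<integral>\<^sup>+u. ennreal (cmod (case (u, \<eta>) of (u, \<eta>) \<Rightarrow> indicator (TB n \<times> TB n) (u, \<eta>) *\<^sub>R (K z w u \<eta> * f (u, \<eta>)))) \<partial>Leb n \<partial>Leb n)"
    by (rule nn_integral_snd[symmetric]) measurable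
  also have "\<dots> = (\<integral>\<^sup>+\<eta>. \<integral>\<^sup>+u. (indicator (TB n) \<eta> * ennreal (weight_kernel n (snd a) (snd b) (snd c) w \<eta>)) *
        (indicator (TB n) u * ennreal (weight_kernel n (fst a) (fst b) (fst c) z u * cmod (f (u, \<eta>)))) \<partial>Leb n \<partial>Leb n)"
  proof (intro nn_integral_cong)
    fix u \<eta>
    show "ennreal (cmod (case (u, \<eta>) of (u, \<eta>) \<Rightarrow> indicator (TB n \<times> TB n) (u, \<eta>) *\<^sub>R (K z w u \<eta> * f (u, \<eta>))))
       = (indicator (TB n) \<eta> * ennreal (weight_kernel n (snd a) (snd b) (snd c) w \<eta>)) *
        (indicator (TB n) u * ennreal (weight_kernel n (fst a) (fst b) (fst c) z u * cmod (f (u, \<eta>))))"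
      by (cases "u \<in> TB n"; cases "\<eta> \<in> TB n")
        (simp_all add: norm_mult cmod_K[OF z w] weight_kernel_nonneg ennreal_mult[symmetric] mult_ac)
  qed
  also have "\<dots> = (\<integral>\<^sup>+\<eta>. (indicator (TB n) \<eta> * ennreal (weight_kernel n (snd a) (snd b) (snd c) w \<eta>)) *
        (\<integral>\<^sup>+u. (indicator (TB n) u * ennreal (weight_kernel n (fst a) (fst b) (fst c) z u * cmod (f (u, \<eta>)))) \<partial>Leb n) \<partial>Leb n)"
    by (intro nn_integral_cong nn_integral_cmult) measurable
  finally show ?thesis by (simp add: mult_ac)
qed

lemma bounded_to_LinfI:
  assumes p: "1 < p"
    and a1: "fst a > 0" and a2: "snd a \<ge> 0" and b1: "p * (fst b + 1) > \<alpha>1 + 1" and b2: "snd b \<ge> \<alpha>2"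
    and c1: "fst c = real n + 1 + fst a + fst b - (real n + 1 + \<alpha>1) / p"
    and c2: "snd c = snd a + snd b - \<alpha>2"
  shows "bounded_to_Linf n p \<alpha>1 \<alpha>2 K"
proof -
  interpret L: sigma_finite_measure "Leb n" by (rule sigma_finite_Leb)
  note [measurable] = rho_measurable[OF n] weight_kernel_measurable[OF n] TB_sets[OF n]
  define q where "q = p / (p - 1)"
  define s where "s = q * (fst b - \<alpha>1) + \<alpha>1"
  have pq: "p > 1" "q > 1" "1/p + 1/q = 1" using p by (auto simp: q_def field_simps)
  have pe: "1/p = 1 - 1/q" using pq by simp
  \<comment> \<open>Multiplied by q, the condition on c1 is the vanishing of the exponent of
    \<open>rho n z\<close>. It also shows that c1 q exceeds n + 1 + s by exactly a1 q, so a1 > 0 is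
    the convergence condition at infinity.\<close>
  have c1q: "fst c * q = real n + 1 + s + fst a * q"
  proof -
    have "(real n + 1 + \<alpha>1) / p = (real n + 1 + \<alpha>1) * (1 - 1/q)" by (simp flip: pe)
    then show ?thesis using pq unfolding c1 s_def by (simp add: field_simps)
  qed
  \<comment> \<open>s + 1 = q (b1 + 1) - (q - 1)(\<alpha>1 + 1), and q - 1 = q/p.\<close>
  have s1: "s > -1"
  proof -
    have "fst b + 1 > (\<alpha>1 + 1) * (1/p)" using b1 p by (simp add: field_simps)
    then have "q * (fst b + 1) > q * ((\<alpha>1 + 1) * (1 - 1/q))" using pq unfolding pe by simp
    also have "q * ((\<alpha>1 + 1) * (1 - 1/q)) = (\<alpha>1 + 1) * (q - 1)" using pq by (simp add: field_simps)
    finally show ?thesis by (simp add: s_def algebra_simps)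
  qed
  have "FR_const n s (fst c * q) < \<infinity>"
    unfolding FR_const_finite[OF n] using s1 a1 pq by (simp add: c1q)
  then have fin: "enn_root q (FR_const n s (fst c * q)) < \<infinity>" by (auto simp flip: top.not_eq_extremum)
  define R where "R = enn2real (enn_root q (FR_const n s (fst c * q)))"
  have R: "enn_root q (FR_const n s (fst c * q)) = ennreal R" using fin by (simp add: R_def)
  define C where "C = 2 powr (snd c) * R"
  have C0: "R \<ge> 0" by (simp add: R_def)
  \<comment> \<open>Bounding the integral of the modulus yields integrability and the norm estimate
    together, at every point of \<open>TB n \<times> TB n\<close>.\<close>
  have bound: "(\<integral>\<^sup>+p. ennreal (cmod (case p of (u, \<eta>) \<Rightarrow> indicator (TB n \<times> TB n) (u, \<eta>) *\<^sub>R (K z w u \<eta> * f (u, \<eta>)))) \<partial>(Leb n \<Otimes>\<^sub>M Leb n))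
     \<le> ennreal C * mixnorm n p \<alpha>1 \<alpha>2 f" (is "?L \<le> _")
    if z: "z \<in> TB n" and w: "w \<in> TB n" and f[measurable]: "f \<in> borel_measurable (Leb n \<Otimes>\<^sub>M Leb n)" for z w f
  proof -
    let ?N = "\<lambda>\<eta>. enn_root p (\<integral>\<^sup>+u. indicator (TB n) u * ennreal (cmod (f (u, \<eta>)) powr p * rho n u powr \<alpha>1) \<partial>Leb n)"
    have "?L \<le> (\<integral>\<^sup>+\<eta>. ennreal C * (indicator (TB n) \<eta> * ?N \<eta> * ennreal (rho n \<eta> powr \<alpha>2)) \<partial>Leb n)"
      unfolding nn_integral_cmod_integrand[OF z w f]
    proof (rule nn_integral_mono)
      fix \<eta> assume "\<eta> \<in> space (Leb n)"
      then have [measurable]: "(\<lambda>u. f (u, \<eta>)) \<in> borel_measurable (Leb n)" by measurable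
      let ?J = "\<integral>\<^sup>+u. indicator (TB n) u * ennreal (weight_kernel n (fst a) (fst b) (fst c) z u * cmod (f (u, \<eta>))) \<partial>Leb n"
      have J: "?J \<le> ennreal R * ?N \<eta>"
        unfolding R[symmetric]
        by (rule weight_kernel_Hoelder[OF n z pq s_def]) (auto simp: c1q)
      show "indicator (TB n) \<eta> * (ennreal (weight_kernel n (snd a) (snd b) (snd c) w \<eta>) * ?J)
         \<le> ennreal C * (indicator (TB n) \<eta> * ?N \<eta> * ennreal (rho n \<eta> powr \<alpha>2))"
      proof (cases "\<eta> \<in> TB n")
        case True
        have "ennreal (weight_kernel n (snd a) (snd b) (snd c) w \<eta>) * ?J
            \<le> ennreal (2 powr snd c * rho n \<eta> powr \<alpha>2) * (ennreal R * ?N \<eta>)"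
          by (intro mult_mono ennreal_leI weight_kernel_le[OF w True a2 b2 c2] J) auto
        also have "\<dots> = ennreal C * (?N \<eta> * ennreal (rho n \<eta> powr \<alpha>2))"
          using C0 by (simp add: C_def ennreal_mult mult_ac)
        finally show ?thesis using True by simp
      qed simp
    qed
    also have "\<dots> = ennreal C * mixnorm n p \<alpha>1 \<alpha>2 f"
      unfolding mixnorm_def by (rule nn_integral_cmult) measurable
    finally show ?thesis .
  qed
  show ?thesis
    unfolding bounded_to_Linf_def
  proof (intro exI[of _ C] allI impI AE_I2)
    fix f zw
    assume f: "f \<in> borel_measurable (Leb n \<Otimes>\<^sub>M Leb n) \<and> mixnorm n p \<alpha>1 \<alpha>2 f < \<infinity>"
      and "zw \<in> TB n \<times> TB n"
    then have zw: "fst zw \<in> TB n" "snd zw \<in> TB n" by auto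
    note b = bound[OF zw conjunct1[OF f]]
    have int: "integrable (Leb n \<Otimes>\<^sub>M Leb n)
      (\<lambda>(u, \<eta>). indicator (TB n \<times> TB n) (u, \<eta>) *\<^sub>R (K (fst zw) (snd zw) u \<eta> * f (u, \<eta>)))"
    proof (rule integrableI_bounded)
      show "(\<integral>\<^sup>+p. ennreal (cmod (case p of (u, \<eta>) \<Rightarrow> indicator (TB n \<times> TB n) (u, \<eta>) *\<^sub>R (K (fst zw) (snd zw) u \<eta> * f (u, \<eta>)))) \<partial>(Leb n \<Otimes>\<^sub>M Leb n)) < \<infinity>"
        using f by (intro le_less_trans[OF b]) (auto simp: ennreal_mult_less_top)
    qed (use integrand_measurable[OF zw] f in auto)
    moreover have "ennreal (cmod (intop n K f (fst zw) (snd zw))) \<le> ennreal C * mixnorm n p \<alpha>1 \<alpha>2 f"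
      unfolding intop_def using integral_norm_bound_ennreal[OF int] b by (rule order_trans)
    ultimately show "integrable (Leb n \<Otimes>\<^sub>M Leb n)
      (\<lambda>(u, \<eta>). indicator (TB n \<times> TB n) (u, \<eta>) *\<^sub>R (K (fst zw) (snd zw) u \<eta> * f (u, \<eta>)))
      \<and> ennreal (cmod (intop n K f (fst zw) (snd zw))) \<le> ennreal C * mixnorm n p \<alpha>1 \<alpha>2 f" ..
  qed
qed

end

section \<open>Necessity\<close>

text \<open>Plays the role of a compact exhaustion of the tube: finite measure, and all powers of
  \<open>rho\<close> and \<open>rho2\<close> are bounded on each set. \<open>Suc m\<close> keeps the
  lower bound for \<open>rho\<close> meaningful at m = 0.\<close>

definition TB_exhaust :: "nat \<Rightarrow> nat \<Rightarrow> (nat \<Rightarrow> complex) set" where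
  "TB_exhaust n m = {u \<in> TB n. 1 / real (Suc m) \<le> rho n u \<and> (\<forall>j<n. cmod (u j) \<le> real (Suc m))}"

lemma TB_exhaust_subset: "TB_exhaust n m \<subseteq> TB n"
  by (auto simp: TB_exhaust_def)

lemma TB_exhaust_mono: assumes "m \<le> m'" shows "TB_exhaust n m \<subseteq> TB_exhaust n m'"
proof
  fix u assume u: "u \<in> TB_exhaust n m"
  have "1 / real (Suc m') \<le> 1 / real (Suc m)" using assms by (intro divide_left_mono) auto
  then show "u \<in> TB_exhaust n m'" using u assms by (fastforce simp: TB_exhaust_def)
qed

lemma TB_exhaust_sets [measurable]: assumes n: "1 \<le> n" shows "TB_exhaust n m \<in> sets (Leb n)"
proof -
  note [measurable] = rho_measurable[OF n] TB_sets[OF n]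
  have "{u \<in> space (Leb n). cmod (u j) \<le> real (Suc m)} \<in> sets (Leb n)" if "j < n" for j
    by (intro borel_measurable_le measurable_compose[OF component_measurable_Leb[OF that] borel_measurable_norm]) auto
  then have "{u \<in> space (Leb n). \<forall>j\<in>{..<n}. cmod (u j) \<le> real (Suc m)} \<in> sets (Leb n)"
    by (intro sets.sets_Collect_finite_All) auto
  moreover have "TB n \<inter> {u \<in> space (Leb n). 1 / real (Suc m) \<le> rho n u} \<in> sets (Leb n)" by measurable
  ultimately have "TB n \<inter> {u \<in> space (Leb n). 1 / real (Suc m) \<le> rho n u} \<inter>
      {u \<in> space (Leb n). \<forall>j\<in>{..<n}. cmod (u j) \<le> real (Suc m)} \<in> sets (Leb n)" by auto
  also have "TB n \<inter> {u \<in> space (Leb n). 1 / real (Suc m) \<le> rho n u} \<inter>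
      {u \<in> space (Leb n). \<forall>j\<in>{..<n}. cmod (u j) \<le> real (Suc m)} = TB_exhaust n m"
    by (auto simp: TB_exhaust_def TB_def)
  finally show ?thesis .
qed

text \<open>The inequalities are strict so that they persist at points close to z.\<close>

lemma TB_exhaust_eventually:
  assumes "z \<in> TB n"
  obtains m where "1 / real (Suc m) < rho n z" "\<And>j. j < n \<Longrightarrow> cmod (z j) < real (Suc m)"
proof -
  obtain m1 where m1: "1 / real (Suc m1) < rho n z"
    using rho_pos[OF assms] nat_approx_posE by blast
  obtain m2 :: nat where m2: "(\<Sum>j<n. cmod (z j)) < real m2" using reals_Archimedean2 by blast
  have "cmod (z j) \<le> (\<Sum>j<n. cmod (z j))" if "j < n" for j
    using that by (intro member_le_sum) auto
  moreover have "1 / real (Suc (m1 + m2)) \<le> 1 / real (Suc m1)" by (intro divide_left_mono) auto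
  ultimately show ?thesis using m1 m2 by (intro that[of "m1 + m2"]) fastforce+
qed

lemma UN_TB_exhaust: "(\<Union>m. TB_exhaust n m) = TB n"
proof
  show "TB n \<subseteq> (\<Union>m. TB_exhaust n m)"
  proof
    fix z assume z: "z \<in> TB n"
    obtain m where "1 / real (Suc m) < rho n z" "\<And>j. j < n \<Longrightarrow> cmod (z j) < real (Suc m)"
      using TB_exhaust_eventually[OF z] by metis
    then have "z \<in> TB_exhaust n m" using z by (auto simp: TB_exhaust_def less_imp_le)
    then show "z \<in> (\<Union>m. TB_exhaust n m)" by blast
  qed
qed (use TB_exhaust_subset in blast)

lemma emeasure_PiE_Leb:
  assumes "\<And>j. j < n \<Longrightarrow> A j \<in> sets borel"
  shows "emeasure (Leb n) (PiE {..<n} A) = (\<Prod>j<n. emeasure lborel (A j))"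
proof -
  interpret product_sigma_finite "\<lambda>_::nat. lborel :: complex measure"
    by unfold_locales
  show ?thesis unfolding Leb_def using assms by (subst emeasure_PiM) auto
qed

lemma PiE_sets_Leb: "(\<And>j. j < n \<Longrightarrow> A j \<in> sets borel) \<Longrightarrow> PiE {..<n} A \<in> sets (Leb n)"
  unfolding Leb_def by (intro sets_PiM_I_finite) auto

lemma emeasure_TB_exhaust_finite: "emeasure (Leb n) (TB_exhaust n m) < \<infinity>"
proof -
  have "emeasure (Leb n) (TB_exhaust n m) \<le> emeasure (Leb n) (PiE {..<n} (\<lambda>_. cball 0 (real (Suc m))))"
    by (intro emeasure_mono PiE_sets_Leb) (auto simp: TB_exhaust_def TB_def space_Leb PiE_iff extensional_def)
  also have "\<dots> < \<infinity>"
    by (subst emeasure_PiE_Leb)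
       (auto simp: less_top[symmetric] power_eq_top_ennreal less_imp_neq[OF emeasure_lborel_cball_finite[unfolded infinity_ennreal_def]])
  finally show ?thesis .
qed

section \<open>From almost every point to every point\<close>

text \<open>A product of balls around the coordinates of z has positive measure, so it cannot avoid
  a set of full measure.\<close>

lemma AE_Leb_approx:
  assumes AE: "AE x in Leb n. P x" and "0 < e"
  shows "\<exists>x. x \<in> space (Leb n) \<and> P x \<and> (\<forall>j<n. dist (x j) (z j) < e)"
proof (rule ccontr)
  assume no: "\<not> ?thesis"
  let ?N = "PiE {..<n} (\<lambda>j. ball (z j) e)"
  have sets: "?N \<in> sets (Leb n)" by (intro PiE_sets_Leb) auto
  have "AE x in Leb n. x \<notin> ?N"
    using AE AE_space
  proof eventually_elim
    case (elim x)
    then show ?case using no by (auto simp: PiE_iff dist_commute)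
  qed
  then have "emeasure (Leb n) ?N = 0"
    using sets by (subst (asm) AE_iff_measurable[OF sets]) (auto dest: sets.sets_into_space)
  then have "(\<Prod>j<n. emeasure lborel (ball (z j) e)) = 0" by (subst (asm) emeasure_PiE_Leb) auto
  then obtain j where "emeasure lborel (ball (z j) e) = 0" by auto
  then have "measure lborel (ball (z j) e) = 0" by (simp add: measure_def)
  then show False using content_ball_pos[OF \<open>0 < e\<close>, of "z j"] by simp
qed

lemma rho_tendsto:
  assumes "1 \<le> n" "\<And>j. j < n \<Longrightarrow> (\<lambda>k. zs k j) \<longlonglongrightarrow> z j"
  shows "(\<lambda>k. rho n (zs k)) \<longlonglongrightarrow> rho n z"
  unfolding rho_def using assms by (intro tendsto_intros) auto

lemma rho2_tendsto:
  assumes "1 \<le> n" "\<And>j. j < n \<Longrightarrow> (\<lambda>k. zs k j) \<longlonglongrightarrow> z j" "\<And>j. j < n \<Longrightarrow> (\<lambda>k. us k j) \<longlonglongrightarrow> u j"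
  shows "(\<lambda>k. rho2 n (zs k) (us k)) \<longlonglongrightarrow> rho2 n z u"
  unfolding rho2_def using assms by (intro tendsto_intros) auto

text \<open>One index m serves the limit and the tail of the sequence; this uniformity supplies the
  dominating function later.\<close>

lemma TB_exhaust_LIMSEQ:
  assumes n: "1 \<le> n" and z: "z \<in> TB n" and zs: "\<And>k. zs k \<in> space (Leb n)"
    and lim: "\<And>j. j < n \<Longrightarrow> (\<lambda>k. zs k j) \<longlonglongrightarrow> z j"
  shows "\<exists>m. z \<in> TB_exhaust n m \<and> (\<forall>\<^sub>F k in sequentially. zs k \<in> TB_exhaust n m)"
proof -
  obtain m where m: "1 / real (Suc m) < rho n z" "\<And>j. j < n \<Longrightarrow> cmod (z j) < real (Suc m)"
    using TB_exhaust_eventually[OF z] by metis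
  have "\<forall>\<^sub>F k in sequentially. 1 / real (Suc m) < rho n (zs k)"
    using rho_tendsto[OF n lim] m(1) by (rule order_tendstoD)
  moreover have "\<forall>\<^sub>F k in sequentially. \<forall>j\<in>{..<n}. cmod (zs k j) < real (Suc m)"
    using m(2) lim by (intro eventually_ball_finite ballI order_tendstoD(2)[OF tendsto_norm]) auto
  ultimately have "\<forall>\<^sub>F k in sequentially. zs k \<in> TB_exhaust n m"
  proof eventually_elim
    case (elim k)
    have "0 < 1 / real (Suc m)" by simp
    then have "0 < rho n (zs k)" using elim(1) by (rule less_trans)
    then show ?case using elim zs[of k] by (auto simp: TB_exhaust_def TB_def less_imp_le)
  qed
  moreover have "z \<in> TB_exhaust n m" using z m by (auto simp: TB_exhaust_def less_imp_le)
  ultimately show ?thesis by blast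
qed

lemma LIMSEQ_of_dist_inverse:
  assumes "\<And>k. dist (x k) l < 1 / real (Suc k)" shows "x \<longlonglongrightarrow> l"
proof (rule tendstoI)
  fix e :: real assume "0 < e"
  then obtain N where N: "1 / real (Suc N) < e" using nat_approx_posE by blast
  have "dist (x k) l < e" if "k \<ge> N" for k
  proof -
    have "1 / real (Suc k) \<le> 1 / real (Suc N)" using that by (intro divide_left_mono) auto
    then show ?thesis using assms[of k] N by linarith
  qed
  then show "\<forall>\<^sub>F k in sequentially. dist (x k) l < e" by (auto simp: eventually_sequentially)
qed

lemma AE_Leb_sequence:
  assumes n: "1 \<le> n" and AE: "AE x in Leb n. P x" and z: "z \<in> TB n"
  obtains zs m where "\<And>k. zs k \<in> TB_exhaust n m" "z \<in> TB_exhaust n m" "\<And>k. P (zs k)"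
    "\<And>j. j < n \<Longrightarrow> (\<lambda>k. zs k j) \<longlonglongrightarrow> z j"
proof -
  have "\<forall>k. \<exists>x. x \<in> space (Leb n) \<and> P x \<and> (\<forall>j<n. dist (x j) (z j) < 1 / real (Suc k))"
    by (intro allI AE_Leb_approx[OF AE]) auto
  then obtain zs where zs: "\<And>k. zs k \<in> space (Leb n)" "\<And>k. P (zs k)"
    "\<And>k j. j < n \<Longrightarrow> dist (zs k j) (z j) < 1 / real (Suc k)" by metis
  have lim: "(\<lambda>k. zs k j) \<longlonglongrightarrow> z j" if "j < n" for j
    using zs(3)[OF that] by (rule LIMSEQ_of_dist_inverse)
  obtain m where m: "z \<in> TB_exhaust n m" "\<forall>\<^sub>F k in sequentially. zs k \<in> TB_exhaust n m"
    using TB_exhaust_LIMSEQ[OF n z zs(1) lim] by blast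
  then obtain N where N: "\<And>k. k \<ge> N \<Longrightarrow> zs k \<in> TB_exhaust n m" by (auto simp: eventually_sequentially)
  show thesis
    by (rule that[of "\<lambda>k. zs (k + N)" m]) (use N m zs lim in \<open>auto intro: LIMSEQ_ignore_initial_segment\<close>)
qed

text \<open>By Fubini for null sets the choice is made in two stages: first \<open>zs k\<close> with
  almost every second coordinate admissible, then \<open>ws k\<close> near w for that particular
  \<open>zs k\<close>. A shift of the index discards the finitely many terms outside the common
  set.\<close>

lemma AE_Leb_pair_sequence:
  assumes n: "1 \<le> n" and AE: "AE x in Leb n \<Otimes>\<^sub>M Leb n. P x" and z: "z \<in> TB n" and w: "w \<in> TB n"
  obtains zs ws m where "\<And>k. zs k \<in> TB_exhaust n m" "\<And>k. ws k \<in> TB_exhaust n m"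
    "z \<in> TB_exhaust n m" "w \<in> TB_exhaust n m" "\<And>k. P (zs k, ws k)"
    "\<And>j. j < n \<Longrightarrow> (\<lambda>k. zs k j) \<longlonglongrightarrow> z j" "\<And>j. j < n \<Longrightarrow> (\<lambda>k. ws k j) \<longlonglongrightarrow> w j"
proof -
  interpret pair_sigma_finite "Leb n" "Leb n" by (rule pair_sigma_finite_Leb)
  have AE2: "AE x in Leb n. AE y in Leb n. P (x, y)"
    using AE by (rule AE_pair)
  obtain zs m1 where zs: "\<And>k. zs k \<in> TB_exhaust n m1" "z \<in> TB_exhaust n m1"
     "\<And>k. AE y in Leb n. P (zs k, y)" "\<And>j. j < n \<Longrightarrow> (\<lambda>k. zs k j) \<longlonglongrightarrow> z j"
    using AE_Leb_sequence[OF n AE2 z] by metis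
  have "\<forall>k. \<exists>y. y \<in> space (Leb n) \<and> P (zs k, y) \<and> (\<forall>j<n. dist (y j) (w j) < 1 / real (Suc k))"
    by (intro allI AE_Leb_approx[OF zs(3)]) auto
  then obtain ws where ws: "\<And>k. ws k \<in> space (Leb n)" "\<And>k. P (zs k, ws k)"
    "\<And>k j. j < n \<Longrightarrow> dist (ws k j) (w j) < 1 / real (Suc k)" by metis
  have lim: "(\<lambda>k. ws k j) \<longlonglongrightarrow> w j" if "j < n" for j
    using ws(3)[OF that] by (rule LIMSEQ_of_dist_inverse)
  obtain m2 where m2: "w \<in> TB_exhaust n m2" "\<forall>\<^sub>F k in sequentially. ws k \<in> TB_exhaust n m2"
    using TB_exhaust_LIMSEQ[OF n w ws(1) lim] by blast
  then obtain N where N: "\<And>k. k \<ge> N \<Longrightarrow> ws k \<in> TB_exhaust n m2" by (auto simp: eventually_sequentially)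
  have sub: "TB_exhaust n m1 \<subseteq> TB_exhaust n (max m1 m2)" "TB_exhaust n m2 \<subseteq> TB_exhaust n (max m1 m2)"
    by (auto intro!: TB_exhaust_mono simp: subset_iff[symmetric])
  show thesis
    by (rule that[of "\<lambda>k. zs (k + N)" "max m1 m2" "\<lambda>k. ws (k + N)"])
      (use sub N m2 ws zs lim in \<open>auto intro: LIMSEQ_ignore_initial_segment\<close>)
qed

text \<open>A power is monotone in one direction or the other, so the sum of the endpoint values is
  a bound that does not depend on the sign of e.\<close>

lemma powr_le_endpoints:
  fixes x :: real assumes "0 < l" "l \<le> x" "x \<le> h"
  shows "x powr e \<le> l powr e + h powr e"
proof (cases "e \<ge> 0")
  case True
  then have "x powr e \<le> h powr e" using assms by (intro powr_mono2) auto
  then show ?thesis by (simp add: add_increasing)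
next
  case False
  then have "x powr e \<le> l powr e" using assms by (intro powr_mono2') auto
  then show ?thesis by (simp add: add_increasing2)
qed

lemma TB_exhaust_rho_powr_bounded:
  assumes n: "1 \<le> n"
  shows "\<exists>B\<ge>0. \<forall>u\<in>TB_exhaust n m. rho n u powr e \<le> B"
proof (intro exI conjI ballI)
  fix u assume u: "u \<in> TB_exhaust n m"
  have "rho n u \<le> Im (u (n-1))" by (simp add: rho_def sum_nonneg)
  also have "\<dots> \<le> cmod (u (n-1))" using abs_Im_le_cmod[of "u (n-1)"] by linarith
  also have "\<dots> \<le> real (Suc m)" using u n by (auto simp: TB_exhaust_def)
  finally show "rho n u powr e \<le> (1 / real (Suc m)) powr e + real (Suc m) powr e"
    using u by (intro powr_le_endpoints) (auto simp: TB_exhaust_def)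
qed simp

lemma nn_integral_TB_exhaust_finite:
  fixes h :: "(nat \<Rightarrow> complex) \<Rightarrow> real"
  assumes n: "1 \<le> n" and h: "\<And>u. 0 \<le> h u" "\<And>u. h u \<le> H" "\<And>u. u \<notin> TB_exhaust n m \<Longrightarrow> h u = 0"
  shows "(\<integral>\<^sup>+u. indicator (TB n) u * ennreal (h u * rho n u powr e) \<partial>Leb n) < \<infinity>"
proof -
  let ?E = "TB_exhaust n m"
  note [measurable] = TB_exhaust_sets[OF n]
  obtain B where B: "B \<ge> 0" "\<And>u. u \<in> ?E \<Longrightarrow> rho n u powr e \<le> B"
    using TB_exhaust_rho_powr_bounded[OF n] by metis
  have "(\<integral>\<^sup>+u. indicator (TB n) u * ennreal (h u * rho n u powr e) \<partial>Leb n)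
     \<le> (\<integral>\<^sup>+u. ennreal (H * B) * indicator ?E u \<partial>Leb n)"
  proof (rule nn_integral_mono)
    fix u
    show "indicator (TB n) u * ennreal (h u * rho n u powr e) \<le> ennreal (H * B) * indicator ?E u"
    proof (cases "u \<in> ?E")
      case True
      have "h u * rho n u powr e \<le> H * B"
        using h(1)[of u] h(2)[of u] B True by (intro mult_mono) auto
      then show ?thesis using True by (auto simp: indicator_def intro!: ennreal_leI)
    qed (use h in auto)
  qed
  also have "\<dots> = ennreal (H * B) * emeasure (Leb n) ?E"
    by (subst nn_integral_cmult_indicator) auto
  also have "\<dots> < \<infinity>" using emeasure_TB_exhaust_finite by (simp add: ennreal_mult_less_top)
  finally show ?thesis .
qed

lemma TB_exhaust_rho2_powr_bounded:
  assumes n: "1 \<le> n"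
  shows "\<exists>B\<ge>0. \<forall>z\<in>TB_exhaust n m. \<forall>u\<in>TB_exhaust n m. cmod (rho2 n z u) powr e \<le> B"
proof -
  let ?M = "real (Suc m)"
  define H where "H = (1/4) * ((\<Sum>j<n-1. (2*?M)\<^sup>2) + 2 * (2*?M))"
  show ?thesis
  proof (intro exI[of _ "(1 / ?M) powr e + H powr e"] conjI ballI)
    fix z u assume z: "z \<in> TB_exhaust n m" and u: "u \<in> TB_exhaust n m"
    have d: "cmod (z j - cnj (u j)) \<le> 2*?M" if "j < n" for j
    proof -
      have "cmod (z j - cnj (u j)) \<le> cmod (z j) + cmod (u j)"
        using norm_triangle_ineq4[of "z j" "cnj (u j)"] by simp
      also have "\<dots> \<le> ?M + ?M" using z u that by (intro add_mono) (auto simp: TB_exhaust_def)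
      finally show ?thesis by simp
    qed
    have "cmod ((\<Sum>j<n - 1. (z j - cnj (u j))\<^sup>2) - 2 * \<i> * (z (n - 1) - cnj (u (n - 1))))
       \<le> cmod (\<Sum>j<n - 1. (z j - cnj (u j))\<^sup>2) + cmod (2 * \<i> * (z (n - 1) - cnj (u (n - 1))))"
      by (rule norm_triangle_ineq4)
    also have "\<dots> \<le> (\<Sum>j<n-1. (2*?M)\<^sup>2) + 2 * (2*?M)"
    proof (rule add_mono)
      show "cmod (\<Sum>j<n - 1. (z j - cnj (u j))\<^sup>2) \<le> (\<Sum>j<n-1. (2*?M)\<^sup>2)"
      proof (rule sum_norm_le)
        fix j assume "j \<in> {..<n-1}"
        then show "cmod ((z j - cnj (u j))\<^sup>2) \<le> (2*?M)\<^sup>2"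
          unfolding norm_power by (intro power_mono d) auto
      qed
      show "cmod (2 * \<i> * (z (n - 1) - cnj (u (n - 1)))) \<le> 2 * (2*?M)"
        using d[of "n-1"] n by (simp add: norm_mult)
    qed
    finally have up: "cmod (rho2 n z u) \<le> H"
      unfolding rho2_def H_def norm_mult by simp
    have "1 / ?M \<le> rho n z" "1 / ?M \<le> rho n u" using z u by (auto simp: TB_exhaust_def)
    then have "1 / ?M + 1 / ?M \<le> rho n z + rho n u" by (rule add_mono)
    then have "1 / ?M \<le> (rho n z + rho n u) / 2" by simp
    then have lo: "1 / ?M \<le> cmod (rho2 n z u)" using cmod_rho2_ge order_trans by blast
    show "cmod (rho2 n z u) powr e \<le> (1 / ?M) powr e + H powr e"
      by (rule powr_le_endpoints[OF _ lo up]) simp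
  qed simp
qed

lemma weight_kernel_bounded:
  assumes n: "1 \<le> n"
  shows "\<exists>B\<ge>0. \<forall>z\<in>TB_exhaust n m. \<forall>u\<in>TB_exhaust n m. weight_kernel n a b c z u \<le> B"
proof -
  obtain B1 where B1: "B1 \<ge> 0" "\<And>z. z \<in> TB_exhaust n m \<Longrightarrow> rho n z powr a \<le> B1"
    using TB_exhaust_rho_powr_bounded[OF n] by metis
  obtain B2 where B2: "B2 \<ge> 0" "\<And>z. z \<in> TB_exhaust n m \<Longrightarrow> rho n z powr b \<le> B2"
    using TB_exhaust_rho_powr_bounded[OF n] by metis
  obtain B3 where B3: "B3 \<ge> 0" "\<And>z u. z \<in> TB_exhaust n m \<Longrightarrow> u \<in> TB_exhaust n m \<Longrightarrow> cmod (rho2 n z u) powr -c \<le> B3"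
    using TB_exhaust_rho2_powr_bounded[OF n] by metis
  show ?thesis
    unfolding weight_kernel_def
    by (intro exI[of _ "B1 * B2 * B3"] conjI ballI mult_mono B1 B2 B3 mult_nonneg_nonneg) auto
qed

lemma weight_kernel_tendsto:
  assumes n: "1 \<le> n" and w: "w \<in> TB n" and \<eta>: "\<eta> \<in> TB n"
    and lim: "\<And>j. j < n \<Longrightarrow> (\<lambda>k. zs k j) \<longlonglongrightarrow> \<eta> j"
  shows "(\<lambda>k. weight_kernel n a b c w (zs k)) \<longlonglongrightarrow> weight_kernel n a b c w \<eta>"
  unfolding weight_kernel_def
  using rho_pos[OF \<eta>] cmod_rho2_pos[OF w \<eta>]
  by (intro tendsto_intros rho_tendsto[OF n lim] rho2_tendsto[OF n _ lim]) auto

lemma enn_root_powr_mult: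
  assumes "0 \<le> x" "p > 0"
  shows "enn_root p (ennreal (x powr p) * I) = ennreal x * enn_root p I"
proof (cases "x = 0 \<or> I = top")
  case True
  then show ?thesis using assms
    by (cases "x = 0") (auto simp: ennreal_mult_top enn_root_def)
next
  case False
  then obtain i where i: "I = ennreal i" "0 \<le> i" by (cases I) auto
  have "ennreal (x powr p) * I = ennreal (x powr p * i)" using i by (simp add: ennreal_mult)
  then have "enn_root p (ennreal (x powr p) * I) = ennreal ((x powr p * i) powr (1/p))"
    using i by (simp add: enn_root_ennreal)
  also have "\<dots> = ennreal (x * i powr (1/p))" using assms i by (simp add: powr_mult powr_powr)
  finally show ?thesis using assms i by (simp add: enn_root_ennreal ennreal_mult)
qed

section \<open>Testing the operator on tensor products\<close>

context TB_kernel
begin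

lemma K_nonzero: "z \<in> TB n \<Longrightarrow> w \<in> TB n \<Longrightarrow> u \<in> TB n \<Longrightarrow> \<eta> \<in> TB n \<Longrightarrow> K z w u \<eta> \<noteq> 0"
  using cmod_K[of z w u \<eta>] weight_kernel_pos by (metis less_irrefl mult_pos_pos norm_zero)

text \<open>The bound that holds for almost every \<open>(z, w)\<close> is transported to every \<open>(z, w)\<close>, because
  \<open>intop n K f\<close> is continuous for bounded \<open>f\<close> supported in \<open>TB_exhaust\<close>; this allows \<open>f\<close> to
  carry the conjugate phase of the kernel at the given point.\<close>

lemma bounded_imp_tensor_bound:
  assumes bdd: "\<And>f. f \<in> borel_measurable (Leb n \<Otimes>\<^sub>M Leb n) \<Longrightarrow> mixnorm n p \<alpha>1 \<alpha>2 f < \<infinity> \<Longrightarrow>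
       AE zw in Leb n \<Otimes>\<^sub>M Leb n. zw \<in> TB n \<times> TB n \<longrightarrow>
         ennreal (cmod (intop n K f (fst zw) (snd zw))) \<le> ennreal C * mixnorm n p \<alpha>1 \<alpha>2 f"
    and p: "1 < p" and z: "z \<in> TB n" and w: "w \<in> TB n"
    and g1[measurable]: "g1 \<in> borel_measurable (Leb n)" and g2[measurable]: "g2 \<in> borel_measurable (Leb n)"
    and g1_bd: "\<And>u. 0 \<le> g1 u" "\<And>u. g1 u \<le> G" "\<And>u. u \<notin> TB_exhaust n m \<Longrightarrow> g1 u = 0"
    and g2_bd: "\<And>u. 0 \<le> g2 u" "\<And>u. g2 u \<le> G" "\<And>u. u \<notin> TB_exhaust n m \<Longrightarrow> g2 u = 0"
  shows "(\<integral>\<^sup>+u. indicator (TB n) u * ennreal (weight_kernel n (fst a) (fst b) (fst c) z u * g1 u) \<partial>Leb n) *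
         (\<integral>\<^sup>+\<eta>. indicator (TB n) \<eta> * ennreal (weight_kernel n (snd a) (snd b) (snd c) w \<eta> * g2 \<eta>) \<partial>Leb n)
    \<le> ennreal C * (enn_root p (\<integral>\<^sup>+u. indicator (TB n) u * ennreal (g1 u powr p * rho n u powr \<alpha>1) \<partial>Leb n) *
         (\<integral>\<^sup>+\<eta>. indicator (TB n) \<eta> * ennreal (g2 \<eta> * rho n \<eta> powr \<alpha>2) \<partial>Leb n))"
proof -
  interpret pair_sigma_finite "Leb n" "Leb n" by (rule pair_sigma_finite_Leb)
  note [measurable] = rho_measurable[OF n] weight_kernel_measurable[OF n] TB_sets[OF n] TB_exhaust_sets[OF n]
  let ?E = "TB_exhaust n m"
  let ?P = "Leb n \<Otimes>\<^sub>M Leb n"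
  \<comment> \<open>Off \<open>TB n \<times> TB n\<close> the value of \<open>k0\<close> is 0, and
    its phase is 0/0 = 0. The modulus of f is still g1 g2 everywhere, because one of g1, g2 vanishes
    unless both points lie in \<open>?E\<close>, where the kernel is nonzero.\<close>
  define k0 where "k0 = (\<lambda>p. indicator (TB n \<times> TB n) p *\<^sub>R K z w (fst p) (snd p))"
  have k0[measurable]: "k0 \<in> borel_measurable ?P" unfolding k0_def by (rule K_measurable[OF z w])
  have cnj[measurable]: "cnj \<in> borel_measurable borel"
    by (intro borel_measurable_continuous_onI continuous_intros)
  define f where "f = (\<lambda>p. complex_of_real (g1 (fst p) * g2 (snd p)) * (cnj (k0 p) / complex_of_real (cmod (k0 p))))"
  have f[measurable]: "f \<in> borel_measurable ?P" unfolding f_def by measurable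
  have E: "u \<in> TB n" if "u \<in> ?E" for u using that TB_exhaust_subset by blast
  have G: "0 \<le> G" using g1_bd(1,2) order_trans by blast
  have f0: "f (u, \<eta>) = 0" if "u \<notin> ?E \<or> \<eta> \<notin> ?E" for u \<eta>
    using that g1_bd(3) g2_bd(3) by (auto simp: f_def)
  have cmod_f: "cmod (f (u, \<eta>)) = g1 u * g2 \<eta>" for u \<eta>
  proof (cases "u \<in> ?E \<and> \<eta> \<in> ?E")
    case True
    then have "k0 (u, \<eta>) \<noteq> 0" using K_nonzero[OF z w E E] E by (simp add: k0_def)
    then show ?thesis using g1_bd(1) g2_bd(1) by (simp add: f_def norm_mult norm_divide)
  qed (use f0[of u \<eta>] g1_bd(3) g2_bd(3) in auto)
  let ?X1 = "\<integral>\<^sup>+u. indicator (TB n) u * ennreal (g1 u powr p * rho n u powr \<alpha>1) \<partial>Leb n"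
  let ?X2 = "\<integral>\<^sup>+\<eta>. indicator (TB n) \<eta> * ennreal (g2 \<eta> * rho n \<eta> powr \<alpha>2) \<partial>Leb n"
  have mix: "mixnorm n p \<alpha>1 \<alpha>2 f = enn_root p ?X1 * ?X2"
  proof -
    have "(\<integral>\<^sup>+u. indicator (TB n) u * ennreal (cmod (f (u, \<eta>)) powr p * rho n u powr \<alpha>1) \<partial>Leb n)
       = ennreal (g2 \<eta> powr p) * ?X1" for \<eta>
    proof -
      have "(\<integral>\<^sup>+u. indicator (TB n) u * ennreal (cmod (f (u, \<eta>)) powr p * rho n u powr \<alpha>1) \<partial>Leb n)
        = (\<integral>\<^sup>+u. ennreal (g2 \<eta> powr p) * (indicator (TB n) u * ennreal (g1 u powr p * rho n u powr \<alpha>1)) \<partial>Leb n)"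
        using g1_bd(1) g2_bd(1) by (intro nn_integral_cong) (simp add: cmod_f powr_mult ennreal_mult mult_ac)
      then show ?thesis by (simp add: nn_integral_cmult)
    qed
    then have "mixnorm n p \<alpha>1 \<alpha>2 f = (\<integral>\<^sup>+\<eta>. indicator (TB n) \<eta> * enn_root p (ennreal (g2 \<eta> powr p) * ?X1)
        * ennreal (rho n \<eta> powr \<alpha>2) \<partial>Leb n)"
      unfolding mixnorm_def by simp
    also have "\<dots> = (\<integral>\<^sup>+\<eta>. enn_root p ?X1 * (indicator (TB n) \<eta> * ennreal (g2 \<eta> * rho n \<eta> powr \<alpha>2)) \<partial>Leb n)"
      using p g2_bd(1) by (intro nn_integral_cong) (simp add: enn_root_powr_mult ennreal_mult mult_ac)
    also have "\<dots> = enn_root p ?X1 * ?X2" by (rule nn_integral_cmult) measurable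
    finally show ?thesis .
  qed
  have X1_fin: "?X1 < \<infinity>"
    by (rule nn_integral_TB_exhaust_finite[OF n, where H="G powr p" and m=m]) (use p g1_bd in \<open>auto intro!: powr_mono2\<close>)
  have X2_fin: "?X2 < \<infinity>"
    by (rule nn_integral_TB_exhaust_finite[OF n, where H=G and m=m]) (use g2_bd in auto)
  have "enn_root p ?X1 < \<infinity>" using X1_fin by (auto simp flip: top.not_eq_extremum)
  then have mix_fin: "mixnorm n p \<alpha>1 \<alpha>2 f < \<infinity>"
    unfolding mix using X2_fin by (simp add: ennreal_mult_less_top)
  obtain r where r: "ennreal C * mixnorm n p \<alpha>1 \<alpha>2 f = ennreal r" "0 \<le> r"
    using mix_fin by (cases "ennreal C * mixnorm n p \<alpha>1 \<alpha>2 f") (auto simp: ennreal_mult_eq_top_iff)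
  obtain zs ws m' where zs: "\<And>k. zs k \<in> TB_exhaust n m'" and ws: "\<And>k. ws k \<in> TB_exhaust n m'"
    and zm: "z \<in> TB_exhaust n m'" and wm: "w \<in> TB_exhaust n m'"
    and bd: "\<And>k. (zs k, ws k) \<in> TB n \<times> TB n \<longrightarrow>
         ennreal (cmod (intop n K f (fst (zs k, ws k)) (snd (zs k, ws k)))) \<le> ennreal C * mixnorm n p \<alpha>1 \<alpha>2 f"
    and lim: "\<And>j. j < n \<Longrightarrow> (\<lambda>k. zs k j) \<longlonglongrightarrow> z j" "\<And>j. j < n \<Longrightarrow> (\<lambda>k. ws k j) \<longlonglongrightarrow> w j"
    using AE_Leb_pair_sequence[OF n bdd[OF f mix_fin] z w] by metis
  have zsT: "zs k \<in> TB n" "ws k \<in> TB n" for k using zs ws TB_exhaust_subset by blast+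
  have bd': "cmod (intop n K f (zs k) (ws k)) \<le> r" for k
    using bd[of k] zsT r by simp
  \<comment> \<open>A single set must contain the support of f and all approximating points, so that
    the kernel has one bound and the dominating function is a constant on
    \<open>?E \<times> ?E\<close>.\<close>
  define M where "M = max m m'"
  have EM: "?E \<subseteq> TB_exhaust n M" "TB_exhaust n m' \<subseteq> TB_exhaust n M"
    unfolding M_def by (rule TB_exhaust_mono, simp)+
  obtain B1 where B1: "B1 \<ge> 0" "\<And>z u. z \<in> TB_exhaust n M \<Longrightarrow> u \<in> TB_exhaust n M \<Longrightarrow>
      weight_kernel n (fst a) (fst b) (fst c) z u \<le> B1"
    using weight_kernel_bounded[OF n] by metis
  obtain B2 where B2: "B2 \<ge> 0" "\<And>z u. z \<in> TB_exhaust n M \<Longrightarrow> u \<in> TB_exhaust n M \<Longrightarrow>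
      weight_kernel n (snd a) (snd b) (snd c) z u \<le> B2"
    using weight_kernel_bounded[OF n] by metis
  let ?F = "\<lambda>z w (u, \<eta>). indicator (TB n \<times> TB n) (u, \<eta>) *\<^sub>R (K z w u \<eta> * f (u, \<eta>))"
  have dom: "norm (?F z' w' q) \<le> (B1 * B2 * (G * G)) * indicator (?E \<times> ?E) q"
    if z': "z' \<in> TB_exhaust n M" and w': "w' \<in> TB_exhaust n M" for z' w' q
  proof (cases q)
    case (Pair u \<eta>)
    have T: "z' \<in> TB n" "w' \<in> TB n" using z' w' TB_exhaust_subset by blast+
    show ?thesis
    proof (cases "u \<in> ?E \<and> \<eta> \<in> ?E")
      case True
      then have "cmod (K z' w' u \<eta>) * cmod (f (u, \<eta>)) \<le> (B1 * B2) * (G * G)"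
        unfolding cmod_f cmod_K[OF T E[OF conjunct1[OF True]] E[OF conjunct2[OF True]]]
        using g1_bd g2_bd G B1(1) B2(1) z' w' EM
        by (intro mult_mono B1(2) B2(2) mult_nonneg_nonneg weight_kernel_nonneg) auto
      then show ?thesis using True E Pair by (simp add: norm_mult)
    qed (use f0[of u \<eta>] Pair in auto)
  qed
  have "emeasure ?P (?E \<times> ?E) < \<infinity>"
    using emeasure_TB_exhaust_finite
    by (subst sigma_finite_measure.emeasure_pair_measure_Times[OF sigma_finite_Leb]) (auto simp: ennreal_mult_less_top)
  then have dom_int: "integrable ?P (\<lambda>q. (B1 * B2 * (G * G)) * indicator (?E \<times> ?E) q)"
    by (intro integrable_mult_right integrable_real_indicator) auto
  have conv: "(\<lambda>k. intop n K f (zs k) (ws k)) \<longlonglongrightarrow> intop n K f z w"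
    unfolding intop_def
  proof (rule integral_dominated_convergence[where w="\<lambda>q. (B1 * B2 * (G * G)) * indicator (?E \<times> ?E) q"])
    show "?F z w \<in> borel_measurable ?P" by (rule integrand_measurable[OF z w f])
    show "?F (zs k) (ws k) \<in> borel_measurable ?P" for k by (rule integrand_measurable[OF zsT f])
    show "integrable ?P (\<lambda>q. (B1 * B2 * (G * G)) * indicator (?E \<times> ?E) q)" by (rule dom_int)
    show "AE q in ?P. (\<lambda>k. ?F (zs k) (ws k) q) \<longlonglongrightarrow> ?F z w q"
    proof (rule AE_I2, clarify)
      fix u \<eta>
      show "(\<lambda>k. indicator (TB n \<times> TB n) (u, \<eta>) *\<^sub>R (K (zs k) (ws k) u \<eta> * f (u, \<eta>)))
         \<longlonglongrightarrow> indicator (TB n \<times> TB n) (u, \<eta>) *\<^sub>R (K z w u \<eta> * f (u, \<eta>))"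
      proof (cases "u \<in> TB n \<and> \<eta> \<in> TB n")
        case True
        then show ?thesis
          by (intro tendsto_scaleR tendsto_mult tendsto_const K_tendsto[OF zsT z w _ _ lim]) auto
      qed auto
    qed
    show "AE q in ?P. norm (?F (zs k) (ws k) q) \<le> (B1 * B2 * (G * G)) * indicator (?E \<times> ?E) q" for k
    proof (rule AE_I2)
      fix q
      show "norm (?F (zs k) (ws k) q) \<le> (B1 * B2 * (G * G)) * indicator (?E \<times> ?E) q"
        by (rule dom) (use zs ws EM in auto)
    qed
  qed
  have lim_le: "cmod (intop n K f z w) \<le> r"
    using tendsto_norm[OF conv] bd' by (intro LIMSEQ_le_const2) auto
  \<comment> \<open>At the prescribed point the phases cancel, so the modulus of the integral is the
    integral of the modulus, which then factorises by Tonelli.\<close>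
  have nonneg: "?F z w q = complex_of_real (cmod (?F z w q))" for q
  proof (cases q)
    case (Pair u \<eta>)
    show ?thesis
    proof (cases "u \<in> ?E \<and> \<eta> \<in> ?E")
      case True
      then have k: "k0 (u, \<eta>) = K z w u \<eta>" and nz: "K z w u \<eta> \<noteq> 0"
        using E K_nonzero[OF z w] by (auto simp: k0_def)
      have "K z w u \<eta> * f (u, \<eta>) = complex_of_real (g1 u * g2 \<eta>) * (K z w u \<eta> * cnj (K z w u \<eta>) / complex_of_real (cmod (K z w u \<eta>)))"
        by (simp add: f_def k)
      also have "K z w u \<eta> * cnj (K z w u \<eta>) / complex_of_real (cmod (K z w u \<eta>)) = complex_of_real (cmod (K z w u \<eta>))"
        using nz by (simp add: complex_norm_square[symmetric] power2_eq_square)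
      finally have "K z w u \<eta> * f (u, \<eta>) = complex_of_real (g1 u * g2 \<eta> * cmod (K z w u \<eta>))" by simp
      moreover have "cmod (K z w u \<eta> * f (u, \<eta>)) = g1 u * g2 \<eta> * cmod (K z w u \<eta>)"
        by (simp add: norm_mult cmod_f)
      ultimately show ?thesis using True E by (simp add: Pair)
    qed (use f0[of u \<eta>] Pair in auto)
  qed
  have int: "integrable ?P (?F z w)"
  proof (rule Bochner_Integration.integrable_bound[OF dom_int])
    show "?F z w \<in> borel_measurable ?P" by (rule integrand_measurable[OF z w f])
    show "AE q in ?P. norm (?F z w q) \<le> norm ((B1 * B2 * (G * G)) * indicator (?E \<times> ?E) q)"
    proof (rule AE_I2)
      fix q
      have "norm (?F z w q) \<le> (B1 * B2 * (G * G)) * indicator (?E \<times> ?E) q"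
        by (rule dom) (use zm wm EM in auto)
      also have "\<dots> \<le> norm ((B1 * B2 * (G * G)) * indicator (?E \<times> ?E) q)"
        unfolding real_norm_def by (rule abs_ge_self)
      finally show "norm (?F z w q) \<le> norm ((B1 * B2 * (G * G)) * indicator (?E \<times> ?E) q)" .
    qed
  qed
  have "(\<integral>\<^sup>+q. ennreal (cmod (?F z w q)) \<partial>?P) = ennreal (\<integral>q. cmod (?F z w q) \<partial>?P)"
    using int by (intro nn_integral_eq_integral integrable_norm) auto
  also have "(\<integral>q. cmod (?F z w q) \<partial>?P) = cmod (intop n K f z w)"
  proof -
    have "intop n K f z w = (\<integral>q. complex_of_real (cmod (?F z w q)) \<partial>?P)"
      unfolding intop_def using nonneg by simp
    also have "\<dots> = complex_of_real (\<integral>q. cmod (?F z w q) \<partial>?P)" by simp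
    finally show ?thesis by (simp add: integral_nonneg_AE)
  qed
  also have "ennreal \<dots> \<le> ennreal r" using lim_le by (rule ennreal_leI)
  finally have main: "(\<integral>\<^sup>+q. ennreal (cmod (?F z w q)) \<partial>?P) \<le> ennreal C * mixnorm n p \<alpha>1 \<alpha>2 f"
    unfolding r(1) .
  let ?Y1 = "\<integral>\<^sup>+u. indicator (TB n) u * ennreal (weight_kernel n (fst a) (fst b) (fst c) z u * g1 u) \<partial>Leb n"
  let ?Y2 = "\<integral>\<^sup>+\<eta>. indicator (TB n) \<eta> * ennreal (weight_kernel n (snd a) (snd b) (snd c) w \<eta> * g2 \<eta>) \<partial>Leb n"
  have "(\<integral>\<^sup>+q. ennreal (cmod (?F z w q)) \<partial>?P)
     = (\<integral>\<^sup>+\<eta>. indicator (TB n) \<eta> * (ennreal (weight_kernel n (snd a) (snd b) (snd c) w \<eta>) * (ennreal (g2 \<eta>) * ?Y1)) \<partial>Leb n)"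
    unfolding nn_integral_cmod_integrand[OF z w f]
  proof (intro nn_integral_cong arg_cong2[where f="(*)"] refl)
    fix \<eta>
    have "(\<integral>\<^sup>+u. indicator (TB n) u * ennreal (weight_kernel n (fst a) (fst b) (fst c) z u * cmod (f (u, \<eta>))) \<partial>Leb n)
      = (\<integral>\<^sup>+u. ennreal (g2 \<eta>) * (indicator (TB n) u * ennreal (weight_kernel n (fst a) (fst b) (fst c) z u * g1 u)) \<partial>Leb n)"
      using g1_bd(1) g2_bd(1) by (intro nn_integral_cong) (simp add: cmod_f ennreal_mult weight_kernel_nonneg mult_ac)
    then show "(\<integral>\<^sup>+u. indicator (TB n) u * ennreal (weight_kernel n (fst a) (fst b) (fst c) z u * cmod (f (u, \<eta>))) \<partial>Leb n)
      = ennreal (g2 \<eta>) * ?Y1" by (simp add: nn_integral_cmult)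
  qed
  also have "\<dots> = (\<integral>\<^sup>+\<eta>. ?Y1 * (indicator (TB n) \<eta> * ennreal (weight_kernel n (snd a) (snd b) (snd c) w \<eta> * g2 \<eta>)) \<partial>Leb n)"
    using g2_bd(1) by (intro nn_integral_cong) (simp add: ennreal_mult weight_kernel_nonneg mult_ac)
  also have "\<dots> = ?Y1 * ?Y2" by (rule nn_integral_cmult) measurable
  finally show ?thesis using main unfolding mix by simp
qed

end

text \<open>If all truncated superlevel sets were null, a sequence avoiding them would converge to
  \<eta> and continuity would give \<open>\<Phi> \<eta> \<le> L\<close>. The truncation makes the
  set admissible as the support of a test function.\<close>

lemma exists_superlevel_positive:
  assumes n: "1 \<le> n" and \<eta>: "\<eta> \<in> TB n" and \<Phi>: "L < \<Phi> \<eta>"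
    and cont: "\<And>zs. (\<And>j. j < n \<Longrightarrow> (\<lambda>k. zs k j) \<longlonglongrightarrow> \<eta> j) \<Longrightarrow> (\<lambda>k. \<Phi> (zs k)) \<longlonglongrightarrow> (\<Phi> \<eta> :: real)"
  shows "\<exists>m. \<not> (AE x in Leb n. x \<notin> {x \<in> TB_exhaust n m. L < \<Phi> x})"
proof (rule ccontr)
  assume "\<not> ?thesis"
  then have "\<And>m. AE x in Leb n. x \<notin> {x \<in> TB_exhaust n m. L < \<Phi> x}" by blast
  then have AE: "AE x in Leb n. \<forall>m. x \<notin> {x \<in> TB_exhaust n m. L < \<Phi> x}"
    unfolding AE_all_countable by blast
  obtain zs m where zs: "\<And>k. zs k \<in> TB_exhaust n m" "\<And>k. \<forall>m. zs k \<notin> {x \<in> TB_exhaust n m. L < \<Phi> x}"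
    "\<And>j. j < n \<Longrightarrow> (\<lambda>k. zs k j) \<longlonglongrightarrow> \<eta> j"
    using AE_Leb_sequence[OF n AE \<eta>] by metis
  have "\<Phi> (zs k) \<le> L" for k using zs(1,2)[of k] by force
  then have "\<Phi> \<eta> \<le> L" using cont[OF zs(3)] by (intro LIMSEQ_le_const2) auto
  then show False using \<Phi> by simp
qed

context TB_kernel
begin

text \<open>The converse half of duality in both variables: the indicator of a superlevel set tests
  the L^1 norm in \<eta>, and a truncated Hoelder extremal tests the L^p norm in u.\<close>

lemma bounded_imp_weight_bound:
  assumes bdd: "\<And>f. f \<in> borel_measurable (Leb n \<Otimes>\<^sub>M Leb n) \<Longrightarrow> mixnorm n p \<alpha>1 \<alpha>2 f < \<infinity> \<Longrightarrow>
       AE zw in Leb n \<Otimes>\<^sub>M Leb n. zw \<in> TB n \<times> TB n \<longrightarrow>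
         ennreal (cmod (intop n K f (fst zw) (snd zw))) \<le> ennreal C * mixnorm n p \<alpha>1 \<alpha>2 f"
    and C: "0 \<le> C"
    and pq: "p > 1" "q > 1" "1/p + 1/q = 1"
    and z: "z \<in> TB n" and w: "w \<in> TB n" and \<eta>: "\<eta> \<in> TB n"
  shows "(\<integral>\<^sup>+u. ennreal ((indicator (TB n) u * (weight_kernel n (fst a) (fst b) (fst c) z u * rho n u powr -(\<alpha>1/p))) powr q) \<partial>Leb n)
     \<le> ennreal ((2 * C / (weight_kernel n (snd a) (snd b) (snd c) w \<eta> * rho n \<eta> powr -\<alpha>2)) powr q)"
proof -
  note [measurable] = rho_measurable[OF n] weight_kernel_measurable[OF n] TB_sets[OF n] TB_exhaust_sets[OF n]
  let ?wk1 = "weight_kernel n (fst a) (fst b) (fst c) z"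
  let ?wk2 = "weight_kernel n (snd a) (snd b) (snd c) w"
  define \<Phi> where "\<Phi> = (\<lambda>\<eta>. ?wk2 \<eta> * rho n \<eta> powr -\<alpha>2)"
  \<comment> \<open>Any positive level below \<open>\<Phi> \<eta>\<close> would do; half of it
    produces the 2 in the conclusion.\<close>
  define L where "L = \<Phi> \<eta> / 2"
  have [measurable]: "\<Phi> \<in> borel_measurable (Leb n)" unfolding \<Phi>_def by measurable
  have \<Phi>_pos: "\<Phi> \<eta> > 0" using weight_kernel_pos[OF w \<eta>] rho_pos[OF \<eta>] by (simp add: \<Phi>_def)
  have L: "0 < L" "L < \<Phi> \<eta>" using \<Phi>_pos by (auto simp: L_def)
  have "\<exists>m. \<not> (AE x in Leb n. x \<notin> {x \<in> TB_exhaust n m. L < \<Phi> x})"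
  proof (rule exists_superlevel_positive[where \<Phi>=\<Phi>, OF n \<eta> L(2)])
    fix zs :: "nat \<Rightarrow> nat \<Rightarrow> complex" assume lim: "\<And>j. j < n \<Longrightarrow> (\<lambda>k. zs k j) \<longlonglongrightarrow> \<eta> j"
    show "(\<lambda>k. \<Phi> (zs k)) \<longlonglongrightarrow> \<Phi> \<eta>"
      unfolding \<Phi>_def using rho_pos[OF \<eta>]
      by (intro tendsto_intros weight_kernel_tendsto[OF n w \<eta> lim] rho_tendsto[OF n lim]) auto
  qed
  then obtain m2 where m2: "\<not> (AE x in Leb n. x \<notin> {x \<in> TB_exhaust n m2. L < \<Phi> x})" by blast
  define E where "E = {x \<in> TB_exhaust n m2. L < \<Phi> x}"
  have "E = TB_exhaust n m2 \<inter> {x \<in> space (Leb n). L < \<Phi> x}"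
    unfolding E_def using sets.sets_into_space[OF TB_exhaust_sets[OF n]] by auto
  then have E_sets[measurable]: "E \<in> sets (Leb n)" by simp
  define g2 where "g2 = (\<lambda>x. indicator E x :: real)"
  have g2_meas[measurable]: "g2 \<in> borel_measurable (Leb n)" unfolding g2_def by measurable
  have E_sub: "E \<subseteq> TB_exhaust n m2" by (auto simp: E_def)
  have E_TB: "x \<in> TB n" if "x \<in> E" for x using that E_sub TB_exhaust_subset by blast
  let ?X = "\<integral>\<^sup>+\<eta>. indicator (TB n) \<eta> * ennreal (g2 \<eta> * rho n \<eta> powr \<alpha>2) \<partial>Leb n"
  let ?Y = "\<integral>\<^sup>+\<eta>. indicator (TB n) \<eta> * ennreal (?wk2 \<eta> * g2 \<eta>) \<partial>Leb n"
  have X_fin: "?X < \<infinity>"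
    by (rule nn_integral_TB_exhaust_finite[OF n, where H=1 and m=m2])
      (use E_sub in \<open>auto simp: g2_def indicator_def\<close>)
  have X_pos: "?X \<noteq> 0"
  proof
    assume "?X = 0"
    then have "AE x in Leb n. indicator (TB n) x * ennreal (g2 x * rho n x powr \<alpha>2) = 0"
      by (subst (asm) nn_integral_0_iff_AE) auto
    then have "AE x in Leb n. x \<notin> E"
    proof eventually_elim
      case (elim x)
      show ?case
      proof
        assume "x \<in> E"
        then show False using elim E_TB[of x] rho_pos[of x n] by (simp add: g2_def)
      qed
    qed
    then show False using m2 by (simp add: E_def)
  qed
  have XY: "ennreal L * ?X \<le> ?Y"
  proof (subst nn_integral_cmult[symmetric], measurable, rule nn_integral_mono)
    fix x
    show "ennreal L * (indicator (TB n) x * ennreal (g2 x * rho n x powr \<alpha>2))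
       \<le> indicator (TB n) x * ennreal (?wk2 x * g2 x)"
    proof (cases "x \<in> E")
      case True
      have pos: "rho n x > 0" using rho_pos[OF E_TB[OF True]] .
      have "L * rho n x powr \<alpha>2 \<le> \<Phi> x * rho n x powr \<alpha>2"
        using True by (intro mult_right_mono) (auto simp: E_def)
      also have "\<dots> = ?wk2 x" using pos by (simp add: \<Phi>_def powr_minus field_simps)
      finally show ?thesis
        using True E_TB[OF True] L by (simp add: g2_def ennreal_mult[symmetric] ennreal_leI)
    qed (simp add: g2_def)
  qed
  define v where "v = (\<lambda>u. ?wk1 u * rho n u powr -(\<alpha>1/p))"
  have v_pos: "v u > 0" if "u \<in> TB n" for u
    using weight_kernel_pos[OF z that] rho_pos[OF that] by (simp add: v_def)
  have v_nonneg: "v u \<ge> 0" for u by (simp add: v_def weight_kernel_nonneg)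
  have [measurable]: "v \<in> borel_measurable (Leb n)" unfolding v_def by measurable
  have qp: "(q - 1) * p = q" using pq by (simp add: field_simps)
  define I where "I = (\<lambda>m. \<integral>\<^sup>+u. ennreal (indicator (TB_exhaust n m) u * v u powr q) \<partial>Leb n)"
  have I_le: "I m \<le> ennreal ((C / L) powr q)" for m
  proof -
    obtain m0 where m0: "z \<in> TB_exhaust n m0" using z UN_TB_exhaust by blast
    define M where "M = max m (max m0 m2)"
    have sub: "TB_exhaust n m \<subseteq> TB_exhaust n M" "TB_exhaust n m0 \<subseteq> TB_exhaust n M" "TB_exhaust n m2 \<subseteq> TB_exhaust n M"
      unfolding M_def by (rule TB_exhaust_mono, simp)+
    \<comment> \<open>The equality case of Hoelder: since (q-1)p = q, both the pairing with the
      kernel and the p-th power of the norm of g1 equal \<open>I m\<close>.\<close>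
    define g1 where "g1 = (\<lambda>u. indicator (TB_exhaust n m) u * (v u powr (q - 1) * rho n u powr -(\<alpha>1/p)))"
    have [measurable]: "g1 \<in> borel_measurable (Leb n)" unfolding g1_def by measurable
    obtain B1 where B1: "B1 \<ge> 0" "\<And>z u. z \<in> TB_exhaust n M \<Longrightarrow> u \<in> TB_exhaust n M \<Longrightarrow>
        weight_kernel n (fst a) (fst b) (fst c) z u \<le> B1"
      using weight_kernel_bounded[OF n] by metis
    obtain B2 where B2: "B2 \<ge> 0" "\<And>u. u \<in> TB_exhaust n M \<Longrightarrow> rho n u powr -(\<alpha>1/p) \<le> B2"
      using TB_exhaust_rho_powr_bounded[OF n] by metis
    define G1 where "G1 = (B1 * B2) powr (q - 1) * B2"
    have g1_le: "g1 u \<le> G1" for u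
    proof (cases "u \<in> TB_exhaust n m")
      case True
      then have u: "u \<in> TB_exhaust n M" using sub by blast
      have "v u \<le> B1 * B2"
        unfolding v_def using B1(1) m0 sub u by (intro mult_mono B1(2) B2(2)) (auto simp: weight_kernel_nonneg)
      then have "v u powr (q - 1) * rho n u powr -(\<alpha>1/p) \<le> G1"
        unfolding G1_def using pq v_nonneg B2 u by (intro mult_mono powr_mono2) auto
      then show ?thesis using True by (simp add: g1_def)
    qed (use B2 in \<open>simp add: g1_def G1_def\<close>)
    have g1_0: "g1 u = 0" if "u \<notin> TB_exhaust n m" for u using that by (simp add: g1_def)
    have g1_nonneg: "g1 u \<ge> 0" for u by (simp add: g1_def)
    let ?A = "\<integral>\<^sup>+u. indicator (TB n) u * ennreal (?wk1 u * g1 u) \<partial>Leb n"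
    let ?D = "\<integral>\<^sup>+u. indicator (TB n) u * ennreal (g1 u powr p * rho n u powr \<alpha>1) \<partial>Leb n"
    have TBm: "u \<in> TB n" if "u \<in> TB_exhaust n m" for u using that TB_exhaust_subset by blast
    have A: "?A = I m"
      unfolding I_def
    proof (rule nn_integral_cong)
      fix u
      show "indicator (TB n) u * ennreal (?wk1 u * g1 u) = ennreal (indicator (TB_exhaust n m) u * v u powr q)"
      proof (cases "u \<in> TB_exhaust n m")
        case True
        have "?wk1 u * (v u powr (q - 1) * rho n u powr -(\<alpha>1/p)) = v u powr 1 * v u powr (q - 1)"
          using v_nonneg[of u] by (simp add: v_def)
        also have "\<dots> = v u powr q" unfolding powr_add[symmetric] by simp
        finally show ?thesis using True TBm[OF True] by (simp add: g1_def)
      qed (simp add: g1_def)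
    qed
    have D: "?D = I m"
      unfolding I_def
    proof (rule nn_integral_cong)
      fix u
      show "indicator (TB n) u * ennreal (g1 u powr p * rho n u powr \<alpha>1) = ennreal (indicator (TB_exhaust n m) u * v u powr q)"
      proof (cases "u \<in> TB_exhaust n m")
        case True
        have r: "rho n u > 0" using rho_pos[OF TBm[OF True]] .
        have "(v u powr (q - 1) * rho n u powr -(\<alpha>1/p)) powr p * rho n u powr \<alpha>1
           = v u powr ((q - 1) * p) * (rho n u powr -\<alpha>1 * rho n u powr \<alpha>1)"
          using pq by (simp add: powr_mult powr_powr mult_ac)
        also have "\<dots> = v u powr q" using r unfolding qp by (simp flip: powr_add)
        finally show ?thesis using True TBm[OF True] by (simp add: g1_def)
      qed (use pq in \<open>simp add: g1_def\<close>)
    qed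
    \<comment> \<open>Finiteness, ensured by the truncation, is what permits dividing by the p-th
      root of \<open>I m\<close> below; the resulting bound is independent of m, so monotone
      convergence removes the truncation.\<close>
    have I_fin: "I m < \<infinity>"
      unfolding D[symmetric]
      by (rule nn_integral_TB_exhaust_finite[OF n, where H="G1 powr p" and m=m])
        (use pq g1_le g1_0 g1_nonneg in \<open>auto intro!: powr_mono2\<close>)
    have "?A * ?Y \<le> ennreal C * (enn_root p ?D * ?X)"
    proof (rule bounded_imp_tensor_bound[OF bdd pq(1) z w, where G="max G1 1" and m=M])
      show "g1 u \<le> max G1 1" for u using g1_le[of u] by simp
      show "g1 u = 0" if "u \<notin> TB_exhaust n M" for u using that sub g1_0 by blast
      show "g2 u = 0" if "u \<notin> TB_exhaust n M" for u using that sub E_sub by (auto simp: g2_def indicator_def)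
      show "g2 u \<le> max G1 1" for u by (auto simp: g2_def indicator_def)
    qed (use g1_nonneg in \<open>auto simp: g2_def\<close>)
    then have "I m * ?Y \<le> ennreal C * (enn_root p (I m) * ?X)" unfolding A D .
    then have "I m * (ennreal L * ?X) \<le> ennreal C * (enn_root p (I m) * ?X)"
      using XY by (meson mult_left_mono order_trans zero_le)
    then have le: "?X * (I m * ennreal L) \<le> ?X * (ennreal C * enn_root p (I m))"
      by (simp add: mult_ac)
    \<comment> \<open>The integral of g2 cancels since it is neither 0, by the choice of the
      superlevel set, nor infinite.\<close>
    have le': "I m * ennreal L \<le> ennreal C * enn_root p (I m)"
      using le X_pos X_fin by (subst (asm) ennreal_mult_le_mult_iff) auto
    obtain i where i: "I m = ennreal i" "0 \<le> i" using I_fin by (cases "I m") auto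
    have "ennreal (i * L) \<le> ennreal (C * i powr (1/p))"
      using le' L C unfolding i by (simp add: enn_root_ennreal i(2) ennreal_mult)
    then have iL: "i * L \<le> C * i powr (1/p)" using C by (simp add: ennreal_le_iff)
    have "i \<le> (C / L) powr q"
    proof (cases "i = 0")
      case False
      then have ip: "i > 0" using i by simp
      have "i = i powr (1/q) * i powr (1/p)" using ip pq by (simp flip: powr_add add: add.commute)
      then have "(i powr (1/q) * L) * i powr (1/p) \<le> C * i powr (1/p)" using iL by (simp add: mult_ac)
      then have "i powr (1/q) * L \<le> C" using ip by simp
      then have "i powr (1/q) \<le> C / L" using L by (simp add: pos_le_divide_eq)
      then have "(i powr (1/q)) powr q \<le> (C / L) powr q" using pq by (intro powr_mono2) auto
      then show ?thesis using ip pq by (simp add: powr_powr)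
    qed simp
    then show ?thesis unfolding i by (rule ennreal_leI)
  qed
  have "(\<lambda>m. I m) \<longlonglongrightarrow> (\<integral>\<^sup>+u. ennreal ((indicator (TB n) u * v u) powr q) \<partial>Leb n)"
    unfolding I_def
  proof (rule nn_integral_LIMSEQ)
    show "incseq (\<lambda>m u. ennreal (indicator (TB_exhaust n m) u * v u powr q))"
    proof (intro monoI le_funI)
      fix m m' u assume "m \<le> (m'::nat)"
      then have "TB_exhaust n m \<subseteq> TB_exhaust n m'" by (rule TB_exhaust_mono)
      then show "ennreal (indicator (TB_exhaust n m) u * v u powr q) \<le> ennreal (indicator (TB_exhaust n m') u * v u powr q)"
        by (intro ennreal_leI mult_right_mono) (auto simp: indicator_def)
    qed
    fix u
    show "(\<lambda>m. ennreal (indicator (TB_exhaust n m) u * v u powr q)) \<longlonglongrightarrow> ennreal ((indicator (TB n) u * v u) powr q)"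
    proof (cases "u \<in> TB n")
      case True
      then obtain m0 where m0: "u \<in> TB_exhaust n m0" using UN_TB_exhaust by blast
      have "\<forall>\<^sub>F m in sequentially. ennreal (indicator (TB_exhaust n m) u * v u powr q) = ennreal ((indicator (TB n) u * v u) powr q)"
        using eventually_ge_at_top[of m0]
      proof eventually_elim
        case (elim m)
        then have "u \<in> TB_exhaust n m" using m0 TB_exhaust_mono by blast
        then show ?case using True by simp
      qed
      then show ?thesis by (rule tendsto_eventually)
    next
      case False
      then have "u \<notin> TB_exhaust n m" for m using TB_exhaust_subset by blast
      then show ?thesis using False pq by simp
    qed
  qed measurable
  then have "(\<integral>\<^sup>+u. ennreal ((indicator (TB n) u * v u) powr q) \<partial>Leb n) \<le> ennreal ((C / L) powr q)"
    using I_le by (intro LIMSEQ_le_const2) auto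
  then show ?thesis by (simp add: v_def L_def \<Phi>_def mult_ac)
qed

end

section \<open>Points on the imaginary axis and growth of powers\<close>

definition axis_point :: "nat \<Rightarrow> real \<Rightarrow> nat \<Rightarrow> complex" where
  "axis_point n d = (\<lambda>j\<in>{..<n}. if j = n - 1 then Complex 0 d else 0)"

lemma axis_point_lt: "j < n - 1 \<Longrightarrow> axis_point n d j = 0"
  by (simp add: axis_point_def)

lemma axis_point_last: "1 \<le> n \<Longrightarrow> axis_point n d (n - 1) = Complex 0 d"
  by (simp add: axis_point_def)

lemma rho_axis_point: "1 \<le> n \<Longrightarrow> rho n (axis_point n d) = d"
  unfolding rho_def axis_point_last by (simp add: axis_point_lt)

lemma axis_point_TB: "1 \<le> n \<Longrightarrow> 0 < d \<Longrightarrow> axis_point n d \<in> TB n"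
  by (simp add: TB_def rho_axis_point) (auto simp: axis_point_def space_Leb)

lemma cmod_rho2_axis_point:
  assumes "1 \<le> n" "0 < d" "0 < e"
  shows "cmod (rho2 n (axis_point n d) (axis_point n e)) = (d + e) / 2"
proof -
  have "Im (rho2 n (axis_point n d) (axis_point n e)) = 0"
    unfolding Im_rho2 axis_point_last[OF assms(1)] by (simp add: axis_point_lt)
  moreover have "Re (rho2 n (axis_point n d) (axis_point n e)) = (d + e) / 2"
    unfolding Re_rho2 rho_axis_point[OF assms(1)] by (simp add: axis_point_lt)
  ultimately show ?thesis using assms by (simp add: cmod_eq_Re)
qed

lemma powr_bounded_near_0:
  fixes k B :: real
  assumes "\<And>x. 0 < x \<Longrightarrow> x \<le> 1 \<Longrightarrow> x powr k \<le> B"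
  shows "0 \<le> k"
proof (rule ccontr)
  assume k: "\<not> 0 \<le> k"
  have B: "1 \<le> B" using assms[of 1] by simp
  \<comment> \<open>For k < 0 this point lies in (0,1] and its k-th power is B + 1, beyond the
    bound.\<close>
  define x where "x = (B + 1) powr (1/k)"
  have "x powr k = B + 1" using k B by (simp add: x_def powr_powr)
  moreover have "0 < x" using B by (simp add: x_def)
  moreover have "x \<le> 1 powr (1/k)" unfolding x_def using k B by (intro powr_mono2') (auto simp: divide_nonpos_neg)
  ultimately show False using assms[of x] by simp
qed

lemma powr_bounded_imp_0:
  fixes k B :: real
  assumes "\<And>x. 0 < x \<Longrightarrow> x powr k \<le> B"
  shows "k = 0"
proof -
  have "0 \<le> k" using assms by (rule powr_bounded_near_0)
  moreover have "0 \<le> -k"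
  proof (rule powr_bounded_near_0)
    fix x :: real assume "0 < x"
    then show "x powr -k \<le> B" using assms[of "1/x"] by (simp add: powr_divide powr_minus_divide)
  qed
  ultimately show ?thesis by simp
qed

text \<open>The diagonal d = e leaves a pure power, whose boundedness on all of (0,\<infinity>)
  forces c = a + b. With one variable fixed at 1 and the other in (0,1], the mean lies in [1/2,1],
  so its power is bounded below and only x^a or x^b can be unbounded near 0.\<close>

lemma axis_weight_bounded_imp:
  fixes a b c B :: real
  assumes bd: "\<And>d e. 0 < d \<Longrightarrow> 0 < e \<Longrightarrow> d powr a * e powr b * ((d + e) / 2) powr -c \<le> B"
  shows "c = a + b" "0 \<le> a" "0 \<le> b"
proof -
  have "a + b - c = 0"
  proof (rule powr_bounded_imp_0)
    fix x :: real assume x: "0 < x"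
    have "x powr (a + b - c) = x powr a * x powr b * ((x + x) / 2) powr -c"
      by (simp add: diff_conv_add_uminus powr_add del: add_uminus_conv_diff)
    then show "x powr (a + b - c) \<le> B" using bd[OF x x] by simp
  qed
  then show "c = a + b" by simp
  define C where "C = (1/2) powr c + 1 powr c"
  have C: "C > 0" by (simp add: C_def add_pos_pos)
  have low: "1 \<le> ((1 + x) / 2) powr -c * C" if "0 < x" "x \<le> 1" for x :: real
  proof -
    have "((1 + x) / 2) powr c \<le> C" unfolding C_def using that by (intro powr_le_endpoints) auto
    then have "((1 + x) / 2) powr -c * ((1 + x) / 2) powr c \<le> ((1 + x) / 2) powr -c * C"
      by (intro mult_left_mono) auto
    then show ?thesis using that by (simp flip: powr_add)
  qed
  show "0 \<le> b"
  proof (rule powr_bounded_near_0)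
    fix x :: real assume x: "0 < x" "x \<le> 1"
    have "x powr b * 1 \<le> x powr b * (((1 + x) / 2) powr -c * C)"
      using low[OF x] by (intro mult_left_mono) auto
    also have "\<dots> = (1 powr a * x powr b * ((1 + x) / 2) powr -c) * C" by simp
    also have "\<dots> \<le> B * C" using bd[of 1 x] x C by (intro mult_right_mono) auto
    finally show "x powr b \<le> B * C" by simp
  qed
  show "0 \<le> a"
  proof (rule powr_bounded_near_0)
    fix x :: real assume x: "0 < x" "x \<le> 1"
    have "x powr a * 1 \<le> x powr a * (((1 + x) / 2) powr -c * C)"
      using low[OF x] by (intro mult_left_mono) auto
    also have "\<dots> = (x powr a * 1 powr b * ((x + 1) / 2) powr -c) * C" by (simp add: add.commute)
    also have "\<dots> \<le> B * C" using bd[of x 1] x C by (intro mult_right_mono) auto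
    finally show "x powr a \<le> B * C" by simp
  qed
qed

context TB_kernel
begin

lemma bounded_to_LinfD:
  assumes p: "1 < p" and bounded: "bounded_to_Linf n p \<alpha>1 \<alpha>2 K"
  shows "fst a > 0 \<and> snd a \<ge> 0 \<and> p * (fst b + 1) > \<alpha>1 + 1 \<and> snd b \<ge> \<alpha>2
     \<and> fst c = real n + 1 + fst a + fst b - (real n + 1 + \<alpha>1) / p
     \<and> snd c = snd a + snd b - \<alpha>2"
proof -
  obtain C0 where C0: "\<And>f. f \<in> borel_measurable (Leb n \<Otimes>\<^sub>M Leb n) \<Longrightarrow> mixnorm n p \<alpha>1 \<alpha>2 f < \<infinity> \<Longrightarrow>
       AE zw in Leb n \<Otimes>\<^sub>M Leb n. zw \<in> TB n \<times> TB n \<longrightarrow>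
         integrable (Leb n \<Otimes>\<^sub>M Leb n)
             (\<lambda>(u, \<eta>). indicator (TB n \<times> TB n) (u, \<eta>) *\<^sub>R (K (fst zw) (snd zw) u \<eta> * f (u, \<eta>)))
         \<and> ennreal (cmod (intop n K f (fst zw) (snd zw))) \<le> ennreal C0 * mixnorm n p \<alpha>1 \<alpha>2 f"
    using bounded unfolding bounded_to_Linf_def by blast
  \<comment> \<open>\<open>ennreal\<close> sends negative reals to 0, so replacing a negative
    constant by 0 leaves the bound unchanged.\<close>
  define C where "C = max 0 C0"
  have C: "0 \<le> C" "ennreal C = ennreal C0" by (auto simp: C_def max_def ennreal_neg)
  have bdd: "AE zw in Leb n \<Otimes>\<^sub>M Leb n. zw \<in> TB n \<times> TB n \<longrightarrow>
         ennreal (cmod (intop n K f (fst zw) (snd zw))) \<le> ennreal C * mixnorm n p \<alpha>1 \<alpha>2 f"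
    if "f \<in> borel_measurable (Leb n \<Otimes>\<^sub>M Leb n)" "mixnorm n p \<alpha>1 \<alpha>2 f < \<infinity>" for f
    using C0[OF that] unfolding C(2) by (rule eventually_mono) blast
  define q where "q = p / (p - 1)"
  define s where "s = q * (fst b - \<alpha>1) + \<alpha>1"
  have pq: "p > 1" "q > 1" "1/p + 1/q = 1" using p by (auto simp: q_def field_simps)
  define k where "k = fst a * q + real n + 1 + s - fst c * q"
  define \<Phi> where "\<Phi> = (\<lambda>w \<eta>. weight_kernel n (snd a) (snd b) (snd c) w \<eta> * rho n \<eta> powr -\<alpha>2)"
  \<comment> \<open>z occurs only on the left, w and \<eta> only on the right. One choice of points
    gives finiteness of the constant; moving z along the axis gives k = 0; moving w and \<eta> gives
    the conditions on the second components.\<close>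
  have main: "FR_const n s (fst c * q) * ennreal (rho n z powr k) \<le> ennreal ((2 * C / \<Phi> w \<eta>) powr q)"
    if "z \<in> TB n" "w \<in> TB n" "\<eta> \<in> TB n" for z w \<eta>
    using bounded_imp_weight_bound[OF bdd C(1) pq that]
    unfolding weight_kernel_Lq_norm[OF n that(1) pq s_def] \<Phi>_def k_def .
  have e1: "axis_point n d \<in> TB n" if "0 < d" for d using axis_point_TB[OF n that] .
  let ?e = "axis_point n 1"
  have "FR_const n s (fst c * q) < \<infinity>"
  proof -
    have "FR_const n s (fst c * q) * ennreal (rho n ?e powr k) < \<infinity>"
      using main[of ?e ?e ?e] e1 by (auto intro: le_less_trans)
    then show ?thesis by (simp add: rho_axis_point[OF n])
  qed
  note fin = this[unfolded FR_const_finite[OF n]]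
  obtain F where F: "FR_const n s (fst c * q) = ennreal F" "F > 0"
    using \<open>FR_const n s (fst c * q) < \<infinity>\<close> FR_const_pos[of n s "fst c * q"]
    by (cases "FR_const n s (fst c * q)") auto
  have main': "F * d powr k \<le> (2 * C / \<Phi> w \<eta>) powr q" if "0 < d" "w \<in> TB n" "\<eta> \<in> TB n" for d w \<eta>
  proof -
    have "ennreal (F * d powr k) \<le> ennreal ((2 * C / \<Phi> w \<eta>) powr q)"
      using main[OF e1[OF that(1)] that(2,3)] F by (simp add: rho_axis_point[OF n] ennreal_mult)
    then show ?thesis by (simp add: ennreal_le_iff)
  qed
  have k0: "k = 0"
  proof (rule powr_bounded_imp_0)
    fix d :: real assume "0 < d"
    then show "d powr k \<le> (2 * C / \<Phi> ?e ?e) powr q / F"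
      using main'[of d ?e ?e] e1 F by (simp add: pos_le_divide_eq mult.commute)
  qed
  have bd2: "d powr (snd a) * e powr (snd b - \<alpha>2) * ((d + e) / 2) powr -snd c \<le> 2 * C / F powr (1/q)"
    if d: "0 < d" "0 < e" for d e
  proof -
    let ?w = "axis_point n d" and ?\<eta> = "axis_point n e"
    have \<Phi>: "\<Phi> ?w ?\<eta> = d powr (snd a) * e powr (snd b - \<alpha>2) * ((d + e) / 2) powr -snd c"
      unfolding \<Phi>_def weight_kernel_def rho_axis_point[OF n] cmod_rho2_axis_point[OF n d]
      by (simp add: diff_conv_add_uminus powr_add mult_ac del: add_uminus_conv_diff)
    have pos: "\<Phi> ?w ?\<eta> > 0" unfolding \<Phi> using d by simp
    have "F \<le> (2 * C / \<Phi> ?w ?\<eta>) powr q"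
      using main'[of 1 ?w ?\<eta>] e1 d by simp
    then have "F powr (1/q) \<le> ((2 * C / \<Phi> ?w ?\<eta>) powr q) powr (1/q)"
      using F pq by (intro powr_mono2) auto
    also have "\<dots> = 2 * C / \<Phi> ?w ?\<eta>" using pos C pq by (simp add: powr_powr)
    finally have "\<Phi> ?w ?\<eta> * F powr (1/q) \<le> 2 * C" using pos by (simp add: pos_le_divide_eq mult.commute)
    then show ?thesis unfolding \<Phi>[symmetric] using F by (simp add: pos_le_divide_eq)
  qed
  note second = axis_weight_bounded_imp[OF bd2]
  have c1q: "fst c * q = real n + 1 + s + fst a * q" using k0 by (simp add: k_def)
  have pe: "1/p = 1 - 1/q" using pq by simp
  \<comment> \<open>Once k = 0, the slack in the convergence condition c1 q > n + 1 + s is exactly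
    a1 q.\<close>
  have "fst a * q > 0" using fin c1q by simp
  then have a1: "fst a > 0" using pq by (simp add: zero_less_mult_iff)
  have c1: "fst c = real n + 1 + fst a + fst b - (real n + 1 + \<alpha>1) / p"
  proof -
    have eq: "(real n + 1 + \<alpha>1) / p = (real n + 1 + \<alpha>1) * (1 - 1/q)" by (simp flip: pe)
    have "fst c = (real n + 1 + s + fst a * q) / q" using c1q pq by (simp add: field_simps)
    then show ?thesis unfolding eq using pq(2) by (simp add: s_def field_simps)
  qed
  have b1: "p * (fst b + 1) > \<alpha>1 + 1"
  proof -
    \<comment> \<open>This is s + 1 > 0; multiplied by p/q = p - 1 it becomes the inequality
      wanted.\<close>
    have "q * (fst b - \<alpha>1) + \<alpha>1 + 1 > 0" using fin by (simp add: s_def)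
    then have "p * ((q * (fst b - \<alpha>1) + \<alpha>1 + 1) / q) > 0" using pq by simp
    also have "p * ((q * (fst b - \<alpha>1) + \<alpha>1 + 1) / q) = p * (fst b - \<alpha>1) + (\<alpha>1 + 1) * (p * (1/q))"
      using pq by (simp add: field_simps)
    also have "p * (1/q) = p - 1" using pq by (simp add: field_simps)
    finally show ?thesis by (simp add: algebra_simps)
  qed
  show ?thesis using a1 b1 c1 second by auto
qed

end

section \<open>The two concrete kernels\<close>

lemma cmod_powr_of_real: "x \<noteq> 0 \<Longrightarrow> cmod (x powr complex_of_real r) = cmod x powr r"
  by (simp add: powr_def norm_exp_eq_Re)

text \<open>The principal power is continuous on the right half-plane, which contains every value of
  \<open>rho2\<close> on the tube; the value 0 elsewhere avoids the branch cut.\<close>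

lemma borel_measurable_powr_right_half_plane:
  "(\<lambda>x. if x \<in> {x. 0 < Re x} then x powr complex_of_real r else 0) \<in> borel_measurable borel"
proof (rule borel_measurable_continuous_on_if)
  show "{x. 0 < Re x} \<in> sets borel" by (simp add: open_halfspace_Re_gt)
  show "continuous_on {x. 0 < Re x} (\<lambda>x. x powr complex_of_real r)"
    by (intro continuous_on_powr_complex continuous_intros) auto
qed auto

lemma TB_kernel_Sker: assumes n: "1 \<le> n" shows "TB_kernel n a b c (Sker n a b c)"
proof
  note [measurable] = rho_measurable[OF n] rho2_measurable[OF n] TB_sets[OF n]
  fix z w assume z: "z \<in> TB n" and w: "w \<in> TB n"
  show "(\<lambda>p. indicator (TB n \<times> TB n) p *\<^sub>R Sker n a b c z w (fst p) (snd p)) \<in> borel_measurable (Leb n \<Otimes>\<^sub>M Leb n)"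
    unfolding Sker_def by measurable
  fix u \<eta> assume u: "u \<in> TB n" and \<eta>: "\<eta> \<in> TB n"
  show "cmod (Sker n a b c z w u \<eta>) = weight_kernel n (fst a) (fst b) (fst c) z u * weight_kernel n (snd a) (snd b) (snd c) w \<eta>"
    unfolding Sker_def weight_kernel_def norm_of_real
    by (simp add: powr_minus divide_inverse abs_mult mult_ac)
  fix zs ws :: "nat \<Rightarrow> nat \<Rightarrow> complex"
  assume lim: "\<And>j. j < n \<Longrightarrow> (\<lambda>k. zs k j) \<longlonglongrightarrow> z j" "\<And>j. j < n \<Longrightarrow> (\<lambda>k. ws k j) \<longlonglongrightarrow> w j"
  show "(\<lambda>k. Sker n a b c (zs k) (ws k) u \<eta>) \<longlonglongrightarrow> Sker n a b c z w u \<eta>"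
    unfolding Sker_def
    using rho_pos[OF z] rho_pos[OF w] rho_pos[OF u] rho_pos[OF \<eta>] cmod_rho2_pos[OF z u] cmod_rho2_pos[OF w \<eta>]
    by (intro tendsto_intros rho_tendsto[OF n lim(1)] rho_tendsto[OF n lim(2)]
         rho2_tendsto[OF n lim(1)] rho2_tendsto[OF n lim(2)]) auto
qed (rule n)

lemma TB_kernel_Tker: assumes n: "1 \<le> n" shows "TB_kernel n a b c (Tker n a b c)"
proof
  note [measurable] = rho_measurable[OF n] rho2_measurable[OF n] TB_sets[OF n]
  fix z w assume z: "z \<in> TB n" and w: "w \<in> TB n"
  \<comment> \<open>The truncated power agrees with the principal one wherever the indicator is
    nonzero, so measurability is proved for the truncated kernel and transferred.\<close>
  let ?P = "\<lambda>r x. if x \<in> {x. 0 < Re x} then x powr complex_of_real r else 0"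
  have "(\<lambda>p. indicator (TB n \<times> TB n) p *\<^sub>R
     (complex_of_real (rho n z powr fst a * rho n w powr snd a * rho n (fst p) powr fst b * rho n (snd p) powr snd b)
     / (?P (fst c) (rho2 n z (fst p)) * ?P (snd c) (rho2 n w (snd p))))) \<in> borel_measurable (Leb n \<Otimes>\<^sub>M Leb n)"
    by (intro borel_measurable_scaleR borel_measurable_indicator borel_measurable_divide borel_measurable_times
        measurable_compose[OF _ borel_measurable_powr_right_half_plane]) measurable
  also have "(\<lambda>p. indicator (TB n \<times> TB n) p *\<^sub>R
     (complex_of_real (rho n z powr fst a * rho n w powr snd a * rho n (fst p) powr fst b * rho n (snd p) powr snd b)
     / (?P (fst c) (rho2 n z (fst p)) * ?P (snd c) (rho2 n w (snd p)))))
     = (\<lambda>p. indicator (TB n \<times> TB n) p *\<^sub>R Tker n a b c z w (fst p) (snd p))"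
    by (auto simp: fun_eq_iff Tker_def indicator_def Re_rho2_pos[OF z] Re_rho2_pos[OF w])
  finally show "(\<lambda>p. indicator (TB n \<times> TB n) p *\<^sub>R Tker n a b c z w (fst p) (snd p)) \<in> borel_measurable (Leb n \<Otimes>\<^sub>M Leb n)" .
  fix u \<eta> assume u: "u \<in> TB n" and \<eta>: "\<eta> \<in> TB n"
  have nz: "rho2 n z u \<noteq> 0" "rho2 n w \<eta> \<noteq> 0" using cmod_rho2_pos[OF z u] cmod_rho2_pos[OF w \<eta>] by auto
  have nonpos: "rho2 n z u \<notin> \<real>\<^sub>\<le>\<^sub>0" "rho2 n w \<eta> \<notin> \<real>\<^sub>\<le>\<^sub>0"
    using Re_rho2_pos[OF z u] Re_rho2_pos[OF w \<eta>] by (auto simp: complex_nonpos_Reals_iff)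
  show "cmod (Tker n a b c z w u \<eta>) = weight_kernel n (fst a) (fst b) (fst c) z u * weight_kernel n (snd a) (snd b) (snd c) w \<eta>"
    unfolding Tker_def weight_kernel_def norm_divide norm_mult norm_of_real cmod_powr_of_real[OF nz(1)] cmod_powr_of_real[OF nz(2)]
    by (simp add: powr_minus divide_inverse abs_mult mult_ac)
  fix zs ws :: "nat \<Rightarrow> nat \<Rightarrow> complex"
  assume lim: "\<And>j. j < n \<Longrightarrow> (\<lambda>k. zs k j) \<longlonglongrightarrow> z j" "\<And>j. j < n \<Longrightarrow> (\<lambda>k. ws k j) \<longlonglongrightarrow> w j"
  show "(\<lambda>k. Tker n a b c (zs k) (ws k) u \<eta>) \<longlonglongrightarrow> Tker n a b c z w u \<eta>"
    unfolding Tker_def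
    using rho_pos[OF z] rho_pos[OF w] rho_pos[OF u] rho_pos[OF \<eta>] nz nonpos
    by (intro tendsto_divide tendsto_mult tendsto_of_real tendsto_powr tendsto_powr_complex tendsto_const
         rho_tendsto[OF n lim(1)] rho_tendsto[OF n lim(2)]
         rho2_tendsto[OF n lim(1)] rho2_tendsto[OF n lim(2)]) auto
qed (rule n)

theorem theorem6p8:
  fixes n :: nat and p1 :: real and a b c al :: "real \<times> real"
  assumes "1 \<le> n" and "1 < p1"
    and "fst al > -1" and "snd al > -1"
  shows "(bounded_to_Linf n p1 (fst al) (snd al) (Sker n a b c)
            \<longleftrightarrow> bounded_to_Linf n p1 (fst al) (snd al) (Tker n a b c))
       \<and> (bounded_to_Linf n p1 (fst al) (snd al) (Tker n a b c)
            \<longleftrightarrow> (fst a > 0 \<and> snd a \<ge> 0 \<and> p1 * (fst b + 1) > fst al + 1 \<and> snd b \<ge> snd al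
                 \<and> fst c = real n + 1 + fst a + fst b - (real n + 1 + fst al) / p1
                 \<and> snd c = snd a + snd b - snd al))"
proof -
  interpret S: TB_kernel n a b c "Sker n a b c" by (rule TB_kernel_Sker[OF assms(1)])
  interpret T: TB_kernel n a b c "Tker n a b c" by (rule TB_kernel_Tker[OF assms(1)])
  show ?thesis
    using S.bounded_to_LinfI[OF assms(2)] T.bounded_to_LinfI[OF assms(2)]
      S.bounded_to_LinfD[OF assms(2)] T.bounded_to_LinfD[OF assms(2)] by blast
qed

end
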